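(* Let $\Pi X.\, s\ [\exists\vec{x}.\,\varphi]$ and $\Pi Y.\, t\ [\exists\vec{y}.\,\psi]$ be satisfiable existentially constrained terms, and let $\mathcal{P}os_{X\cup\mathcal{V}al}(s)=\{p_1,\dots,p_n\}$. Then $\Pi X.\, s\ [\exists\vec{x}.\,\varphi] \sim \Pi Y.\, t\ [\exists\vec{y}.\,\psi]$ if and only if all of the following hold: (1) $\mathcal{P}os_{X\cup\mathcal{V}al}(s)=\mathcal{P}os_{Y\cup\mathcal{V}al}(t)$; (2) there exists a renaming $\rho\colon \mathcal{V}ar(s)\setminus X\to\mathcal{V}ar(t)\setminus Y$ such that $\rho(s[\,]_{p_1,\dots,p_n}) = t[\,]_{p_1,\dots,p_n}$; (3) for all $i,j\in\{1,\dots,n\}$, $\vDash_{\mathcal{M}} (\exists\vec{x}.\varphi)\Rightarrow(s|_{p_i}=s|_{p_j})$ iff $\vDash_{\mathcal{M}} (\exists\vec{y}.\psi)\Rightarrow(t|_{p_i}=t|_{p_j})$; (4) for all $i\in\{1,\dots,n\}$ and $v\in\mathcal{V}al$, $\vDash_{\mathcal{M}} (\exists\vec{x}.\varphi)\Rightarrow(s|_{p_i}=v)$ iff $\vDash_{\mathcal{M}} (\exists\vec{y}.\psi)\Rightarrow(t|_{p_i}=v)$; (5) letting $\sim$ denote the relation $\sim_{\mathcal{P}os_{X\cup\mathcal{V}al}(s)}=\sim_{\mathcal{P}os_{Y\cup\mathcal{V}al}(t)}$, and letting $\mu_X,\mu_Y$ be representative substitutions of $\Pi X.\, s\ [\exists\vec{x}.\varphi]$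 and $\Pi Y.\, t\ [\exists\vec{y}.\psi]$, respectively, built using the same representative for each equivalence class $[p_i]_\sim$ ($1\le i\le n$), with $\theta=\{\langle s|_{p_i},t|_{p_i}\rangle\mid 1\le i\le n\}$, $\tilde{X}=\mu_X(X)\cap X$ and $\tilde{Y}=\mu_Y(Y)\cap Y$, the restriction $\theta|_{\tilde{X}}$ is a renaming (bijection) $\tilde{X}\to\tilde{Y}$ and $\vDash_{\mathcal{M}} (\exists\vec{x}.\varphi)\mu_X\theta|_{\tilde{X}} \Leftrightarrow (\exists\vec{y}.\psi)\mu_Y$.
   Context: Fix a many-sorted signature whose sorts are partitioned into theory sorts and term sorts and whose function symbols are partitioned into theory symbols (all argument and result sorts are theory sorts) and term symbols; terms are built from these symbols and sorted variables. A fixed model $\mathcal{M}$ interprets theory sorts and theory symbols; the sort Bool is interpreted as $\{\mathsf{true},\mathsf{false}\}$, the usual connectives and equality are available as theory symbols, and every element of the interpretation of every theory sort is a constant symbol of the signature, called a value; $\mathcal{V}al$ is the set of values. A logical constraint is a Bool-sorted term built from theory symbols and variables. A valuation $\rho$ maps theory-sorted variables to elements of the interpretations of their sorts; $\vDash_{\mathcal{M},\rho}\varphi$ means $\varphi$ evaluates to true under $\rho$. Substitutions are sort-preserving; $\sigma|_U$ agrees with $\sigma$ on $U$ and is the identity elsewhere; $\sigma$ is $X$-valued if $\sigma(X)\subseteq\mathcal{V}al$. A renaming is a bijective substitution from variables to variables (a renaming between variable sets $A\to B$ is a bijection $A\to B$). For a relation $\theta\subseteq A\times B$ and $\tilde{A}\subseteq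 A$, $\theta|_{\tilde{A}}=\{\langle a,b\rangle\in\theta\mid a\in\tilde{A}\}$, used as a substitution when it is a function. $\mathcal{V}ar(\cdot)$ denotes the set of variables occurring in an expression. For a term $s$: $s|_p$ is the subterm at position $p$, $s(p)$ the symbol at $p$, $\mathcal{P}os_U(s)$ the set of positions $p$ with $s(p)\in U$, and $s[\,]_{p_1,\dots,p_n}$ the multihole context obtained by replacing the subterms at parallel positions $p_i$ by holes. An existential constraint $\exists\vec{x}.\,\varphi$ is a pair of a sequence of variables $\vec{x}$ and a logical constraint $\varphi$ with $\{\vec{x}\}\subseteq\mathcal{V}ar(\varphi)$; its free variables are $\mathcal{FV}ar(\exists\vec{x}.\varphi)=\mathcal{V}ar(\varphi)\setminus\{\vec{x}\}$. $\vDash_{\mathcal{M},\rho}\exists\vec{x}.\varphi$ iff there are values $\vec{v}$ with $\vDash_{\mathcal{M},\rho}\varphi\{\vec{x}\mapsto\vec{v}\}$; the constraint is satisfiable if this holds for some $\rho$. For a substitution $\sigma$, $(\exists\vec{x}.\varphi)\sigma := \exists\vec{x}.(\varphi\,\sigma|_{\mathcal{FV}ar(\exists\vec{x}.\varphi)})$, and $\sigma\vDash_{\mathcal{M}}\exists\vec{x}.\varphi$ means $\sigma(\mathcal{FV}ar(\exists\vec{x}.\varphi))\subseteq\mathcal{V}al$ and $\vDash_{\mathcal{M},\rho}(\exists\vec{x}.\varphi)\sigma$ for all $\rho$. $\vDash_{\mathcal{M}} A\Leftrightarrow B$ (resp. $A\Rightarrow B$) means that for every valuation $\rho$, $\vDash_{\mathcal{M},\rho}A$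 iff (resp. implies) $\vDash_{\mathcal{M},\rho}B$; here $B$ may also be an equation between theory terms. An existentially constrained term $\Pi X.\, s\ [\exists\vec{x}.\,\varphi]$ is a triple of a set $X$ of variables, a term $s$ and an existential constraint with $\mathcal{FV}ar(\exists\vec{x}.\varphi)\subseteq X\subseteq\mathcal{V}ar(s)$ and $\{\vec{x}\}\cap\mathcal{V}ar(s)=\emptyset$; it is satisfiable if its constraint is. $\Pi X.\, s\ [\exists\vec{x}.\varphi]$ is subsumed by $\Pi Y.\, t\ [\exists\vec{y}.\psi]$ if for every $X$-valued substitution $\sigma$ with $\sigma\vDash_{\mathcal{M}}\exists\vec{x}.\varphi$ there is a $Y$-valued substitution $\gamma$ with $\gamma\vDash_{\mathcal{M}}\exists\vec{y}.\psi$ and $s\sigma=t\gamma$; the two are equivalent ($\sim$) if each is subsumed by the other. For $\Pi X.\, s\ [\exists\vec{x}.\varphi]$, the relation $\sim_{\mathcal{P}os_{X\cup\mathcal{V}al}(s)}$ on $\mathcal{P}os_{X\cup\mathcal{V}al}(s)$ is: $p\sim q$ iff $\vDash_{\mathcal{M}}(\exists\vec{x}.\varphi)\Rightarrow(s|_p=s|_q)$ (an equivalence relation); $[p]_\sim$ is the class of $p$ and $\hat{p}$ a chosen representative of it. $\mathcal{P}os_{\mathcal{V}al!}(s)$ is the set of $p\in\mathcal{P}os_{X\cup\mathcal{V}al}(s)$ for which some value $v$ satisfies $\vDash_{\mathcal{M}}(\exists\vec{x}.\varphi)\Rightarrow(s|_p=v)$; for satisfiable terms such $v$ is unique and denoted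 $\mathcal{V}al!(p)$. The representative substitution $\mu_X\colon X\to X\cup\mathcal{V}al$ is defined by $\mu_X(z)=\mathcal{V}al!(p)$ if $s(p)=z$ for some $p\in\mathcal{P}os_{\mathcal{V}al!}(s)$, and $\mu_X(z)=s(\hat{p})$ otherwise, where $p$ is a position with $s(p)=z$.
   Formalization: In (5), θ is restricted to pairs in X̃×Ỹ (domain restriction alone fails for f(a,a)[true] vs f(b,c)[b=c]); substitution into ∃x.φ renames bound variables to avoid capture, so each theory sort has infinitely many variables; X, Y consist of theory-sorted variables. *)

theory Defs
  imports Main
begin

datatype (vars_trm: 'v, 'f) trm = Var 'v | Fun 'f "('v, 'f) trm list"

lemma size_nth_trm [termination_simp]:
  "i < length ts \<Longrightarrow> size (ts ! i) < Suc (size_list size ts)"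
  by (metis le_imp_less_Suc nth_mem order_refl size_list_estimation')

type_synonym pos = "nat list"

fun subst_trm :: "('v \<Rightarrow> ('w, 'f) trm) \<Rightarrow> ('v, 'f) trm \<Rightarrow> ('w, 'f) trm" where
  "subst_trm \<sigma> (Var x) = \<sigma> x"
| "subst_trm \<sigma> (Fun f ts) = Fun f (map (subst_trm \<sigma>) ts)"

definition restrict_subst :: "('v \<Rightarrow> ('v, 'f) trm) \<Rightarrow> 'v set \<Rightarrow> 'v \<Rightarrow> ('v, 'f) trm" where
  "restrict_subst \<sigma> U = (\<lambda>x. if x \<in> U then \<sigma> x else Var x)"

fun poss :: "('v, 'f) trm \<Rightarrow> pos set" where
  "poss (Var x) = {[]}"
| "poss (Fun f ts) = insert [] (\<Union>i\<in>{..<length ts}. (#) i ` poss (ts ! i))"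

text \<open>Meaningful only for positions \<open>p \<in> poss s\<close>.\<close>

fun subt_at :: "('v, 'f) trm \<Rightarrow> pos \<Rightarrow> ('v, 'f) trm" where
  "subt_at s [] = s"
| "subt_at (Fun f ts) (i # p) = subt_at (ts ! i) p"
| "subt_at (Var x) (i # p) = undefined"

text \<open>The symbol at the root: a variable (\<open>Inl\<close>) or a function symbol (\<open>Inr\<close>).\<close>

fun root :: "('v, 'f) trm \<Rightarrow> 'v + 'f" where
  "root (Var x) = Inl x"
| "root (Fun f ts) = Inr f"

datatype ('v, 'f) mctxt = Hole | MVar 'v | MFun 'f "('v, 'f) mctxt list"

text \<open>\<open>mctxt_of P s\<close> is \<open>s[ ]\<close> with holes at the positions in \<open>P\<close>.\<close>

fun mctxt_of :: "pos set \<Rightarrow> ('v, 'f) trm \<Rightarrow> ('v, 'f) mctxt" where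
  "mctxt_of P (Var x) = (if [] \<in> P then Hole else MVar x)"
| "mctxt_of P (Fun f ts) = (if [] \<in> P then Hole
     else MFun f (map (\<lambda>i. mctxt_of {p. i # p \<in> P} (ts ! i)) [0..<length ts]))"

text \<open>
  The term sorts and term symbols are the complements of \<open>tsorts\<close> and \<open>tsyms\<close>. The elements of
  the interpretation \<open>carr M \<tau>\<close> of a theory sort are themselves symbols of the signature, hence the
  universe of the model is the type of function symbols.
\<close>

record ('s, 'v, 'f) lc_struct =
  vsort :: "'v \<Rightarrow> 's"
  asorts :: "'f \<Rightarrow> 's list"
  rsort :: "'f \<Rightarrow> 's"
  tsorts :: "'s set"
  tsyms :: "'f set"
  carr :: "'s \<Rightarrow> 'f set"
  intp :: "'f \<Rightarrow> 'f list \<Rightarrow> 'f"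
  boolS :: 's
  ttS :: 'f
  ffS :: 'f
  notS :: 'f
  andS :: 'f
  orS :: 'f
  impS :: 'f
  iffS :: 'f
  eqS :: "'s \<Rightarrow> 'f"

definition tv :: "('s, 'v, 'f) lc_struct \<Rightarrow> bool \<Rightarrow> 'f" where
  "tv M b = (if b then ttS M else ffS M)"

definition bool_connective ::
    "('s, 'v, 'f) lc_struct \<Rightarrow> 'f \<Rightarrow> (bool \<Rightarrow> bool \<Rightarrow> bool) \<Rightarrow> bool" where
  "bool_connective M f F \<longleftrightarrow>
     f \<in> tsyms M \<and> asorts M f = [boolS M, boolS M] \<and> rsort M f = boolS M \<and>
     (\<forall>a b. intp M f [tv M a, tv M b] = tv M (F a b))"

text \<open>
  Assumption \<open>value_syms\<close> makes the interpretations of distinct theory sorts disjoint, because every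
  symbol has a single result sort. Assumption \<open>fresh_vars\<close> guarantees that bound variables of
  constraints can be renamed.
\<close>

locale lc_model =
  fixes M :: "('s, 'v, 'f) lc_struct"
  assumes theory_syms:
      "f \<in> tsyms M \<Longrightarrow> set (asorts M f) \<subseteq> tsorts M \<and> rsort M f \<in> tsorts M"
    and value_syms: "\<tau> \<in> tsorts M \<Longrightarrow> v \<in> carr M \<tau> \<Longrightarrow>
      v \<in> tsyms M \<and> asorts M v = [] \<and> rsort M v = \<tau> \<and> intp M v [] = v"
    and intp_carr: "f \<in> tsyms M \<Longrightarrow> list_all2 (\<lambda>a \<tau>. a \<in> carr M \<tau>) as (asorts M f) \<Longrightarrow>
      intp M f as \<in> carr M (rsort M f)"
    and bool: "boolS M \<in> tsorts M" "carr M (boolS M) = {ttS M, ffS M}" "ttS M \<noteq> ffS M"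
    and neg: "notS M \<in> tsyms M" "asorts M (notS M) = [boolS M]" "rsort M (notS M) = boolS M"
      "intp M (notS M) [tv M b] = tv M (\<not> b)"
    and connectives: "bool_connective M (andS M) (\<and>)" "bool_connective M (orS M) (\<or>)"
      "bool_connective M (impS M) (\<longrightarrow>)" "bool_connective M (iffS M) (\<longleftrightarrow>)"
    and equality: "\<tau> \<in> tsorts M \<Longrightarrow>
      eqS M \<tau> \<in> tsyms M \<and> asorts M (eqS M \<tau>) = [\<tau>, \<tau>] \<and> rsort M (eqS M \<tau>) = boolS M \<and>
      (\<forall>a\<in>carr M \<tau>. \<forall>b\<in>carr M \<tau>. intp M (eqS M \<tau>) [a, b] = tv M (a = b))"
    and fresh_vars: "\<tau> \<in> tsorts M \<Longrightarrow> infinite {x. vsort M x = \<tau>}"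

definition Val :: "('s, 'v, 'f) lc_struct \<Rightarrow> 'f set" where
  "Val M = (\<Union>\<tau>\<in>tsorts M. carr M \<tau>)"

abbreviation val :: "'f \<Rightarrow> ('v, 'f) trm" where
  "val v \<equiv> Fun v []"

fun sort_of :: "('s, 'v, 'f) lc_struct \<Rightarrow> ('v, 'f) trm \<Rightarrow> 's" where
  "sort_of M (Var x) = vsort M x"
| "sort_of M (Fun f ts) = rsort M f"

fun well_sorted :: "('s, 'v, 'f) lc_struct \<Rightarrow> ('v, 'f) trm \<Rightarrow> bool" where
  "well_sorted M (Var x) \<longleftrightarrow> True"
| "well_sorted M (Fun f ts) \<longleftrightarrow>
     map (sort_of M) ts = asorts M f \<and> (\<forall>t\<in>set ts. well_sorted M t)"

fun funs_trm :: "('v, 'f) trm \<Rightarrow> 'f set" where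
  "funs_trm (Var x) = {}"
| "funs_trm (Fun f ts) = insert f (\<Union>t\<in>set ts. funs_trm t)"

definition substitution :: "('s, 'v, 'f) lc_struct \<Rightarrow> ('v \<Rightarrow> ('v, 'f) trm) \<Rightarrow> bool" where
  "substitution M \<sigma> \<longleftrightarrow> (\<forall>x. well_sorted M (\<sigma> x) \<and> sort_of M (\<sigma> x) = vsort M x)"

definition valued :: "('s, 'v, 'f) lc_struct \<Rightarrow> 'v set \<Rightarrow> ('v \<Rightarrow> ('v, 'f) trm) \<Rightarrow> bool" where
  "valued M X \<sigma> \<longleftrightarrow> \<sigma> ` X \<subseteq> val ` Val M"

definition renaming :: "('s, 'v, 'f) lc_struct \<Rightarrow> 'v set \<Rightarrow> 'v set \<Rightarrow> ('v \<Rightarrow> 'v) \<Rightarrow> bool" where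
  "renaming M A B r \<longleftrightarrow> bij_betw r A B \<and> (\<forall>x\<in>A. vsort M (r x) = vsort M x)"

definition valuation :: "('s, 'v, 'f) lc_struct \<Rightarrow> ('v \<Rightarrow> 'f) \<Rightarrow> bool" where
  "valuation M \<rho> \<longleftrightarrow> (\<forall>x. vsort M x \<in> tsorts M \<longrightarrow> \<rho> x \<in> carr M (vsort M x))"

fun eval_trm :: "('s, 'v, 'f) lc_struct \<Rightarrow> ('v \<Rightarrow> 'f) \<Rightarrow> ('v, 'f) trm \<Rightarrow> 'f" where
  "eval_trm M \<rho> (Var x) = \<rho> x"
| "eval_trm M \<rho> (Fun f ts) = intp M f (map (eval_trm M \<rho>) ts)"

definition logical_constraint :: "('s, 'v, 'f) lc_struct \<Rightarrow> ('v, 'f) trm \<Rightarrow> bool" where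
  "logical_constraint M \<phi> \<longleftrightarrow>
     well_sorted M \<phi> \<and> sort_of M \<phi> = boolS M \<and> funs_trm \<phi> \<subseteq> tsyms M"

type_synonym ('v, 'f) ec = "'v list \<times> ('v, 'f) trm"

definition ex_constraint :: "('s, 'v, 'f) lc_struct \<Rightarrow> ('v, 'f) ec \<Rightarrow> bool" where
  "ex_constraint M = (\<lambda>(xs, \<phi>). logical_constraint M \<phi> \<and> set xs \<subseteq> vars_trm \<phi>)"

definition FVar :: "('v, 'f) ec \<Rightarrow> 'v set" where
  "FVar = (\<lambda>(xs, \<phi>). vars_trm \<phi> - set xs)"

definition assign_vals :: "'v list \<Rightarrow> 'f list \<Rightarrow> 'v \<Rightarrow> ('v, 'f) trm" where
  "assign_vals xs vs x = (case map_of (zip xs vs) x of None \<Rightarrow> Var x | Some v \<Rightarrow> val v)"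

definition sat_ec :: "('s, 'v, 'f) lc_struct \<Rightarrow> ('v \<Rightarrow> 'f) \<Rightarrow> ('v, 'f) ec \<Rightarrow> bool" where
  "sat_ec M \<rho> = (\<lambda>(xs, \<phi>).
     \<exists>vs. list_all2 (\<lambda>x v. v \<in> carr M (vsort M x)) xs vs \<and>
          eval_trm M \<rho> (subst_trm (assign_vals xs vs) \<phi>) = ttS M)"

definition satisfiable :: "('s, 'v, 'f) lc_struct \<Rightarrow> ('v, 'f) ec \<Rightarrow> bool" where
  "satisfiable M C \<longleftrightarrow> (\<exists>\<rho>. valuation M \<rho> \<and> sat_ec M \<rho> C)"

definition fresh_renaming :: "('s, 'v, 'f) lc_struct \<Rightarrow> 'v set \<Rightarrow> 'v set \<Rightarrow> 'v \<Rightarrow> 'v" where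
  "fresh_renaming M A U = (SOME r. renaming M A (r ` A) r \<and> r ` A \<inter> U = {})"

text \<open>
  \<open>(\<exists>xs. \<phi>)\<sigma> = (\<exists>xs. \<phi> \<sigma>|\<^sub>F\<^sub>V\<^sub>a\<^sub>r)\<close>. As usual for binders, the bound variables are first renamed to fresh
  ones if some of them would capture a variable introduced by \<open>\<sigma>\<close>.
\<close>

definition subst_ec ::
    "('s, 'v, 'f) lc_struct \<Rightarrow> ('v \<Rightarrow> ('v, 'f) trm) \<Rightarrow> ('v, 'f) ec \<Rightarrow> ('v, 'f) ec" where
  "subst_ec M \<sigma> = (\<lambda>(xs, \<phi>).
     let F = FVar (xs, \<phi>); U = (\<Union>x\<in>F. vars_trm (\<sigma> x)) in
     if set xs \<inter> U = {} then (xs, subst_trm (restrict_subst \<sigma> F) \<phi>)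
     else let r = fresh_renaming M (set xs) (U \<union> vars_trm \<phi>) in
       (map r xs, subst_trm (\<lambda>x. if x \<in> F then \<sigma> x else Var (r x)) \<phi>))"

definition models_ec :: "('s, 'v, 'f) lc_struct \<Rightarrow> ('v \<Rightarrow> ('v, 'f) trm) \<Rightarrow> ('v, 'f) ec \<Rightarrow> bool" where
  "models_ec M \<sigma> C \<longleftrightarrow>
     valued M (FVar C) \<sigma> \<and> (\<forall>\<rho>. valuation M \<rho> \<longrightarrow> sat_ec M \<rho> (subst_ec M \<sigma> C))"

definition valid_iff :: "('s, 'v, 'f) lc_struct \<Rightarrow> ('v, 'f) ec \<Rightarrow> ('v, 'f) ec \<Rightarrow> bool" where
  "valid_iff M C D \<longleftrightarrow> (\<forall>\<rho>. valuation M \<rho> \<longrightarrow> (sat_ec M \<rho> C \<longleftrightarrow> sat_ec M \<rho> D))"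

text \<open>
  Validity of \<open>C \<Rightarrow> (u = w)\<close> for theory terms \<open>u\<close>, \<open>w\<close>. An equation between terms of different
  sorts is false under every valuation, since the interpretations of the sorts are disjoint.
\<close>

definition entails_eq ::
    "('s, 'v, 'f) lc_struct \<Rightarrow> ('v, 'f) ec \<Rightarrow> ('v, 'f) trm \<Rightarrow> ('v, 'f) trm \<Rightarrow> bool" where
  "entails_eq M C u w \<longleftrightarrow>
     (\<forall>\<rho>. valuation M \<rho> \<longrightarrow> sat_ec M \<rho> C \<longrightarrow> eval_trm M \<rho> u = eval_trm M \<rho> w)"

type_synonym ('v, 'f) ect = "'v set \<times> ('v, 'f) trm \<times> ('v, 'f) ec"

text \<open>
  The variables in \<open>X\<close> range over values, so they are required to be of theory sort.
\<close>

definition ex_constrained_term :: "('s, 'v, 'f) lc_struct \<Rightarrow> ('v, 'f) ect \<Rightarrow> bool" where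
  "ex_constrained_term M = (\<lambda>(X, s, C).
     (\<forall>x\<in>X. vsort M x \<in> tsorts M) \<and> well_sorted M s \<and> ex_constraint M C \<and>
     FVar C \<subseteq> X \<and> X \<subseteq> vars_trm s \<and> set (fst C) \<inter> vars_trm s = {})"

definition subsumed :: "('s, 'v, 'f) lc_struct \<Rightarrow> ('v, 'f) ect \<Rightarrow> ('v, 'f) ect \<Rightarrow> bool" where
  "subsumed M = (\<lambda>(X, s, C) (Y, t, D).
     \<forall>\<sigma>. substitution M \<sigma> \<and> valued M X \<sigma> \<and> models_ec M \<sigma> C \<longrightarrow>
       (\<exists>\<gamma>. substitution M \<gamma> \<and> valued M Y \<gamma> \<and> models_ec M \<gamma> D \<and>
            subst_trm \<sigma> s = subst_trm \<gamma> t))"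

definition equivalent :: "('s, 'v, 'f) lc_struct \<Rightarrow> ('v, 'f) ect \<Rightarrow> ('v, 'f) ect \<Rightarrow> bool" where
  "equivalent M S T \<longleftrightarrow> subsumed M S T \<and> subsumed M T S"

definition posXV :: "('s, 'v, 'f) lc_struct \<Rightarrow> 'v set \<Rightarrow> ('v, 'f) trm \<Rightarrow> pos set" where
  "posXV M X s = {p \<in> poss s. root (subt_at s p) \<in> Inl ` X \<union> Inr ` Val M}"

definition pos_eq :: "('s, 'v, 'f) lc_struct \<Rightarrow> ('v, 'f) ect \<Rightarrow> (pos \<times> pos) set" where
  "pos_eq M = (\<lambda>(X, s, C).
     {(p, q). p \<in> posXV M X s \<and> q \<in> posXV M X s \<and> entails_eq M C (subt_at s p) (subt_at s q)})"

text \<open>A choice \<open>p \<mapsto> rep p\<close> of one representative for every equivalence class of \<open>pos_eq\<close>.\<close>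

definition representatives :: "('s, 'v, 'f) lc_struct \<Rightarrow> ('v, 'f) ect \<Rightarrow> (pos \<Rightarrow> pos) \<Rightarrow> bool" where
  "representatives M = (\<lambda>(X, s, C) rep.
     (\<forall>p\<in>posXV M X s. (p, rep p) \<in> pos_eq M (X, s, C)) \<and>
     (\<forall>(p, q)\<in>pos_eq M (X, s, C). rep p = rep q))"

lemma ex_representatives: "\<exists>rep. representatives M S rep"
proof -
  obtain X s C where fields: "S = (X, s, C)"
    by (cases S) blast
  let ?R = "pos_eq M (X, s, C)"
  have refl: "(p, p) \<in> ?R" if "p \<in> posXV M X s" for p
    using that by (simp add: pos_eq_def entails_eq_def)
  have "(p, SOME q. (p, q) \<in> ?R) \<in> ?R" if "p \<in> posXV M X s" for p
    using refl [OF that] by (rule someI)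
  moreover have "(\<lambda>r. (p, r) \<in> ?R) = (\<lambda>r. (q, r) \<in> ?R)" if "(p, q) \<in> ?R" for p q
    using that by (fastforce simp: pos_eq_def entails_eq_def fun_eq_iff)
  ultimately have "representatives M S (\<lambda>p. SOME q. (p, q) \<in> ?R)"
    unfolding fields representatives_def by auto
  then show ?thesis by blast
qed

definition posVal1 :: "('s, 'v, 'f) lc_struct \<Rightarrow> ('v, 'f) ect \<Rightarrow> pos set" where
  "posVal1 M = (\<lambda>(X, s, C).
     {p \<in> posXV M X s. \<exists>v\<in>Val M. entails_eq M C (subt_at s p) (val v)})"

definition Val1 :: "('s, 'v, 'f) lc_struct \<Rightarrow> ('v, 'f) ect \<Rightarrow> pos \<Rightarrow> 'f" where
  "Val1 M = (\<lambda>(X, s, C) p. THE v. v \<in> Val M \<and> entails_eq M C (subt_at s p) (val v))"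

definition rep_subst ::
    "('s, 'v, 'f) lc_struct \<Rightarrow> (pos \<Rightarrow> pos) \<Rightarrow> ('v, 'f) ect \<Rightarrow> 'v \<Rightarrow> ('v, 'f) trm" where
  "rep_subst M rep = (\<lambda>(X, s, C) z.
     if z \<notin> X then Var z
     else if \<exists>p\<in>posVal1 M (X, s, C). subt_at s p = Var z
     then val (Val1 M (X, s, C) (SOME p. p \<in> posVal1 M (X, s, C) \<and> subt_at s p = Var z))
     else subt_at s (rep (SOME p. p \<in> poss s \<and> subt_at s p = Var z)))"

definition rel_to_subst :: "(('v, 'f) trm \<times> ('v, 'f) trm) set \<Rightarrow> 'v \<Rightarrow> ('v, 'f) trm" where
  "rel_to_subst R z = (if \<exists>u. (Var z, u) \<in> R then THE u. (Var z, u) \<in> R else Var z)"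

definition renaming_rel ::
    "('s, 'v, 'f) lc_struct \<Rightarrow> 'v set \<Rightarrow> 'v set \<Rightarrow> (('v, 'f) trm \<times> ('v, 'f) trm) set \<Rightarrow> bool" where
  "renaming_rel M A B R \<longleftrightarrow> (\<exists>r. renaming M A B r \<and> R = (\<lambda>x. (Var x, Var (r x))) ` A)"

text \<open>
  The restriction of \<open>\<theta>\<close> to a relation from the variables in \<open>A\<close> to the variables in \<open>B\<close>. Cutting
  down the range as well is necessary: for \<open>f(a,a) [true]\<close> and \<open>f(b,c) [b = c]\<close> the relation \<open>\<theta>\<close>
  relates \<open>a\<close> to both \<open>b\<close> and \<open>c\<close>, only one of which is a representative.
\<close>

definition restrict_rel ::
    "(('v, 'f) trm \<times> ('v, 'f) trm) set \<Rightarrow> 'v set \<Rightarrow> 'v set \<Rightarrow> (('v, 'f) trm \<times> ('v, 'f) trm) set" where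
  "restrict_rel \<theta> A B = {(u, w) \<in> \<theta>. u \<in> Var ` A \<and> w \<in> Var ` B}"

end

theory Submission
  imports Defs
begin

text \<open>
  Both sides are compared through the set of value tuples \<open>(\<rho>(s|\<^sub>p))\<^sub>p\<close>, where \<open>p\<close> ranges over
  the positions \<open>P\<close> of constrained variables and values and \<open>\<rho>\<close> over the solutions of the constraint.
  Instantiating the unconstrained variables by themselves shows that two terms are equivalent iff they
  have the same \<open>P\<close>, their contexts around \<open>P\<close> are variants of each other, and their sets of value
  tuples coincide. A value tuple is determined by its entries at the representatives of those classes
  of positions that are not forced to a fixed value, and there the constraint instantiated by the
  representative substitution says precisely which entries occur; hence equality of the sets of
  tuples is conditions (3), (4) and (5).
\<close>

text \<open>Entailed equations compare values only, so nothing syntactic says that two identified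
  positions, or corresponding positions of the two terms, carry the same sort. Sorts are recovered
  from a single solution: every value has one result sort, carriers of distinct theory sorts are
  therefore disjoint, and a shared value forces a shared sort. This is one use of satisfiability; it
  also supplies the instance on which terms are compared and makes forced values unique. In
  condition (5) the bijectivity of the restricted relation is automatic once both terms share their
  representatives. What remains is sort preservation, which guarantees that a valuation rebuilt from
  the entries at representatives stays in the right carriers. Conditions (3) and (4) follow from
  equality of the tuple sets. They have to be available before (5) is analysed, because they make
  one choice of representatives, and one set of forced positions, serve both terms.\<close>

section \<open>Terms, positions and contexts\<close>

lemma finite_vars_trm: "finite (vars_trm t)"
  by (induction t) auto

lemma vars_trm_subt_at:
  "x \<in> vars_trm t \<longleftrightarrow> (\<exists>p\<in>poss t. subt_at t p = Var x)"
proof (induction t)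
  case (Var y)
  then show ?case by auto
next
  case (Fun f ts)
  show ?case
  proof
    assume "x \<in> vars_trm (Fun f ts)"
    then obtain i where i: "i < length ts" "x \<in> vars_trm (ts ! i)"
      by (auto simp: in_set_conv_nth)
    then obtain p where "p \<in> poss (ts ! i)" "subt_at (ts ! i) p = Var x"
      using Fun by (metis nth_mem)
    then show "\<exists>p\<in>poss (Fun f ts). subt_at (Fun f ts) p = Var x"
      using i by (intro bexI [of _ "i # p"]) auto
  next
    assume "\<exists>p\<in>poss (Fun f ts). subt_at (Fun f ts) p = Var x"
    then show "x \<in> vars_trm (Fun f ts)"
      using Fun by (fastforce dest: nth_mem)
  qed
qed

lemma eval_subst_trm: "eval_trm M \<rho> (subst_trm \<sigma> t) = eval_trm M (\<lambda>x. eval_trm M \<rho> (\<sigma> x)) t"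
  by (induction t) (auto simp: comp_def cong: map_cong)

lemma eval_trm_cong:
  "(\<And>x. x \<in> vars_trm t \<Longrightarrow> \<rho> x = \<rho>' x) \<Longrightarrow> eval_trm M \<rho> t = eval_trm M \<rho>' t"
proof (induction t)
  case (Fun f ts)
  then have "map (eval_trm M \<rho>) ts = map (eval_trm M \<rho>') ts"
    by (intro map_cong) auto
  then show ?case by (metis eval_trm.simps(2))
qed simp

lemma subt_at_subst_trm:
  "p \<in> poss s \<Longrightarrow> p \<in> poss (subst_trm \<sigma> s) \<and> subt_at (subst_trm \<sigma> s) p = subst_trm \<sigma> (subt_at s p)"
proof (induction s arbitrary: p)
  case (Var x)
  then show ?case by (cases "\<sigma> x") auto
next
  case (Fun f ts)
  have "p \<in> poss (subst_trm \<sigma> (ts ! i)) \<and>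
      subt_at (subst_trm \<sigma> (ts ! i)) p = subst_trm \<sigma> (subt_at (ts ! i) p)"
    if "i < length ts" "p \<in> poss (ts ! i)" for i p
    using that Fun.IH [OF nth_mem] by blast
  then show ?case using Fun.prems by auto
qed

lemma poss_subst_trm_cases:
  assumes "p \<in> poss (subst_trm \<sigma> s)"
  obtains "p \<in> poss s" | q r x where "p = q @ r" "q \<in> poss s" "subt_at s q = Var x" "r \<in> poss (\<sigma> x)"
proof -
  have "p \<in> poss s \<or> (\<exists>q r x. p = q @ r \<and> q \<in> poss s \<and> subt_at s q = Var x \<and> r \<in> poss (\<sigma> x))"
    using assms
  proof (induction s arbitrary: p)
    case (Var x)
    then show ?case by auto
  next
    case (Fun f ts)
    show ?case
    proof (cases p)
      case Nil
      then show ?thesis by simp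
    next
      case (Cons i p')
      with Fun.prems have i: "i < length ts" and "p' \<in> poss (subst_trm \<sigma> (ts ! i))"
        by auto
      then consider "p' \<in> poss (ts ! i)"
        | q r x where "p' = q @ r" "q \<in> poss (ts ! i)" "subt_at (ts ! i) q = Var x" "r \<in> poss (\<sigma> x)"
        using Fun.IH [of "ts ! i" p'] by auto
      then show ?thesis
      proof cases
        case 1
        with i Cons show ?thesis by auto
      next
        case 2
        with i Cons have "p = (i # q) @ r \<and> i # q \<in> poss (Fun f ts) \<and>
            subt_at (Fun f ts) (i # q) = Var x \<and> r \<in> poss (\<sigma> x)"
          by auto
        then show ?thesis by blast
      qed
    qed
  qed
  with that show ?thesis by blast
qed

lemma poss_appendD: "q @ r \<in> poss s \<Longrightarrow> q \<in> poss s \<and> r \<in> poss (subt_at s q)"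
proof (induction q arbitrary: s)
  case Nil
  then show ?case by (cases s) auto
next
  case (Cons i q)
  then show ?case by (cases s) auto
qed

lemma well_sorted_subt_at: "well_sorted M s \<Longrightarrow> p \<in> poss s \<Longrightarrow> well_sorted M (subt_at s p)"
proof (induction s arbitrary: p)
  case (Var x)
  then show ?case by auto
next
  case (Fun f ts)
  have "well_sorted M (subt_at (ts ! i) p)" if "i < length ts" "p \<in> poss (ts ! i)" for i p
    using that Fun.IH [OF nth_mem] Fun.prems by auto
  then show ?case using Fun.prems by auto
qed

text \<open>A common instance makes function symbols facing each other outside the holes equal. The
  other two premises rule out that a variable on one side faces a function symbol on the
  other.\<close>

lemma mctxt_of_eqI:
  assumes "subst_trm \<sigma> s = subst_trm \<gamma> t"
    and "\<And>p x. p \<in> poss s \<Longrightarrow> p \<notin> P \<Longrightarrow> subt_at s p = Var x \<Longrightarrow> subt_at t p = Var (r x)"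
    and "\<And>p y. p \<in> poss t \<Longrightarrow> p \<notin> P \<Longrightarrow> subt_at t p = Var y \<Longrightarrow> \<exists>x. subt_at s p = Var x"
  shows "map_mctxt r id (mctxt_of P s) = mctxt_of P t"
  using assms
proof (induction s arbitrary: t P)
  case (Var x)
  show ?case
  proof (cases "[] \<in> P")
    case True
    then show ?thesis by (cases t) auto
  next
    case False
    then show ?thesis using Var.prems(2) [of "[]" x] by simp
  qed
next
  case (Fun f ts)
  show ?case
  proof (cases "[] \<in> P")
    case True
    then show ?thesis by (cases t) auto
  next
    case False
    \<comment> \<open>If \<open>t\<close> were a variable, the third premise at the root would make
      \<open>Fun f ts\<close> a variable.\<close>
    then obtain g us where t: "t = Fun g us"
      using Fun.prems(3) [of "[]"] by (cases t) auto
    have fg: "f = g" and eq: "map (subst_trm \<sigma>) ts = map (subst_trm \<gamma>) us"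
      using Fun.prems(1) t by auto
    then have len: "length ts = length us" by (metis length_map)
    have "map_mctxt r id (mctxt_of {p. i # p \<in> P} (ts ! i)) = mctxt_of {p. i # p \<in> P} (us ! i)"
      if i: "i < length ts" for i
    proof (rule Fun.IH)
      show "ts ! i \<in> set ts" using i by simp
      show "subst_trm \<sigma> (ts ! i) = subst_trm \<gamma> (us ! i)"
        using eq i len by (metis nth_map)
    next
      fix p x
      assume "p \<in> poss (ts ! i)" "p \<notin> {p. i # p \<in> P}" "subt_at (ts ! i) p = Var x"
      then show "subt_at (us ! i) p = Var (r x)"
        using Fun.prems(2) [of "i # p" x] i t by auto
    next
      fix p y
      assume "p \<in> poss (us ! i)" "p \<notin> {p. i # p \<in> P}" "subt_at (us ! i) p = Var y"
      then show "\<exists>x. subt_at (ts ! i) p = Var x"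
        using Fun.prems(3) [of "i # p" y] i t len by auto
    qed
    then show ?thesis using False t fg len by (simp add: comp_def id_def)
  qed
qed

text \<open>Gluing principle for sufficiency: outside \<open>P\<close> the contexts match up to
  \<open>r\<close>, so instances can differ only at the holes or at context variables.\<close>

lemma subst_trm_eqI_mctxt_of:
  assumes "map_mctxt r id (mctxt_of P s) = mctxt_of P t"
    and "\<And>p. p \<in> P \<Longrightarrow> subst_trm \<sigma> (subt_at s p) = subst_trm \<gamma> (subt_at t p)"
    and "\<And>p x. p \<in> poss s \<Longrightarrow> p \<notin> P \<Longrightarrow> subt_at s p = Var x \<Longrightarrow> \<sigma> x = \<gamma> (r x)"
  shows "subst_trm \<sigma> s = subst_trm \<gamma> t"
  using assms
proof (induction s arbitrary: t P)
  case (Var x)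
  show ?case
  proof (cases "[] \<in> P")
    case True
    then show ?thesis using Var.prems(2) [of "[]"] by simp
  next
    case False
    then have "t = Var (r x)" using Var.prems(1) by (cases t) auto
    then show ?thesis using False Var.prems(3) [of "[]"] by simp
  qed
next
  case (Fun f ts)
  show ?case
  proof (cases "[] \<in> P")
    case True
    then show ?thesis using Fun.prems(2) [of "[]"] by simp
  next
    case False
    then obtain us where t: "t = Fun f us"
      using Fun.prems(1) by (cases t) auto
    have eq: "map (\<lambda>i. map_mctxt r id (mctxt_of {p. i # p \<in> P} (ts ! i))) [0..<length ts] =
        map (\<lambda>i. mctxt_of {p. i # p \<in> P} (us ! i)) [0..<length us]"
      using Fun.prems(1) False t by (simp add: comp_def id_def)
    have len: "length ts = length us"
      using arg_cong [OF eq, of length] by simp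
    have "subst_trm \<sigma> (ts ! i) = subst_trm \<gamma> (us ! i)" if i: "i < length ts" for i
    proof (rule Fun.IH)
      show "ts ! i \<in> set ts" using i by simp
      show "map_mctxt r id (mctxt_of {p. i # p \<in> P} (ts ! i)) = mctxt_of {p. i # p \<in> P} (us ! i)"
        using eq i len by simp
    next
      fix p
      assume "p \<in> {p. i # p \<in> P}"
      then show "subst_trm \<sigma> (subt_at (ts ! i) p) = subst_trm \<gamma> (subt_at (us ! i) p)"
        using Fun.prems(2) [of "i # p"] t by simp
    next
      fix p x
      assume "p \<in> poss (ts ! i)" "p \<notin> {p. i # p \<in> P}" "subt_at (ts ! i) p = Var x"
      then show "\<sigma> x = \<gamma> (r x)"
        using Fun.prems(3) [of "i # p" x] i by auto
    qed
    then show ?thesis using t len by (simp add: list_eq_iff_nth_eq)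
  qed
qed

lemma map_mctxt_mctxt_of_inverse:
  assumes "map_mctxt r id (mctxt_of P s) = mctxt_of P t"
    and "\<And>p x. p \<in> poss s \<Longrightarrow> p \<notin> P \<Longrightarrow> subt_at s p = Var x \<Longrightarrow> r' (r x) = x"
  shows "map_mctxt r' id (mctxt_of P t) = mctxt_of P s"
proof -
  have "map_mctxt (r' \<circ> r) id (mctxt_of P s) = mctxt_of P s"
    using assms(2)
  proof (induction s arbitrary: P)
    case (Var x)
    then show ?case using Var.prems [of "[]" x] by simp
  next
    case (Fun f ts)
    have "map_mctxt (r' \<circ> r) id (mctxt_of {p. i # p \<in> P} (ts ! i)) = mctxt_of {p. i # p \<in> P} (ts ! i)"
      if i: "i < length ts" for i
    proof (rule Fun.IH)
      show "ts ! i \<in> set ts" using i by simp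
    next
      fix p x
      assume "p \<in> poss (ts ! i)" "p \<notin> {p. i # p \<in> P}" "subt_at (ts ! i) p = Var x"
      then show "r' (r x) = x"
        using Fun.prems [of "i # p" x] i by auto
    qed
    then show ?case by (simp add: comp_def id_def)
  qed
  then show ?thesis
    by (simp add: assms(1) [symmetric] mctxt.map_comp)
qed

text \<open>
  Variables outside \<open>X\<close> cannot sit strictly below a variable of \<open>t\<close>, since \<open>t\<close> is in turn matched
  against \<open>s\<close>.
\<close>

lemma variable_position:
  assumes eq: "subst_trm \<sigma> s = subst_trm \<gamma> t" "subst_trm \<sigma>' t = subst_trm \<gamma>' s"
    and nX: "\<And>x. x \<notin> X \<Longrightarrow> \<sigma> x = Var x" and nY: "\<And>y. y \<notin> Y \<Longrightarrow> \<sigma>' y = Var y"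
    and Y: "\<And>y. y \<in> Y \<Longrightarrow> \<gamma> y = val (\<pi> y)"
    and p: "p \<in> poss s" "subt_at s p = Var x" "x \<notin> X"
  obtains y where "y \<notin> Y" "p \<in> poss t" "subt_at t p = Var y" "\<gamma> y = Var x" "\<gamma>' x = Var y"
proof -
  note goal = that
  have pg: "p \<in> poss (subst_trm \<gamma> t)" and px: "subt_at (subst_trm \<gamma> t) p = Var x"
    using subt_at_subst_trm [OF p(1), of \<sigma>] p nX eq(1) by auto
  have fin: thesis if pt: "p \<in> poss t" and y: "subt_at t p = Var y" for y
  proof -
    have \<gamma>y: "\<gamma> y = Var x" using px subt_at_subst_trm [OF pt, of \<gamma>] y by simp
    then have "y \<notin> Y" using Y by force
    moreover have "\<gamma>' x = Var y"
      using subt_at_subst_trm [OF pt, of \<sigma>'] subt_at_subst_trm [OF p(1), of \<gamma>'] y p(2) nY [OF \<open>y \<notin> Y\<close>] eq(2)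
      by simp
    ultimately show thesis using goal \<gamma>y pt y by blast
  qed
  show thesis
    using pg
  proof (cases rule: poss_subst_trm_cases)
    case 1
    then have "subst_trm \<gamma> (subt_at t p) = Var x" using px subt_at_subst_trm [OF 1, of \<gamma>] by simp
    then show ?thesis using fin [OF 1] by (cases "subt_at t p") auto
  next
    case (2 q r y)
    \<comment> \<open>Were \<open>x\<close> brought in strictly below \<open>y\<close>, then
      \<open>y\<close> lies outside \<open>Y\<close>, as values have no proper positions. So
      \<open>\<sigma>'\<close> keeps \<open>y\<close>, and the second equation puts a variable at
      \<open>q\<close> in an instance of \<open>s\<close>, where \<open>s\<close> already has a
      function symbol.\<close>
    have "r = []"
    proof (rule ccontr)
      assume "r \<noteq> []"
      have "y \<notin> Y" using 2(4) Y \<open>r \<noteq> []\<close> by auto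
      then have "subt_at (subst_trm \<gamma>' s) q = Var y"
        using subt_at_subst_trm [OF 2(2), of \<sigma>'] 2(3) nY eq(2) by simp
      moreover have qs: "q \<in> poss s" and "r \<in> poss (subt_at s q)"
        using poss_appendD p(1) 2(1) by blast+
      then obtain f ts where "subt_at s q = Fun f ts"
        using \<open>r \<noteq> []\<close> by (cases "subt_at s q") auto
      ultimately show False using subt_at_subst_trm [OF qs, of \<gamma>'] by simp
    qed
    then show ?thesis using fin 2 by simp
  qed
qed

section \<open>Semantics of existential constraints\<close>

text \<open>Theory symbols take arguments of theory sorts only, so theory sorts propagate downwards
  from the root. Applied to a logical constraint, this gives the bound variables theory
  sorts.\<close>

lemma theory_trm_vars:
  assumes "lc_model M" "funs_trm u \<subseteq> tsyms M" "well_sorted M u" "sort_of M u \<in> tsorts M" "x \<in> vars_trm u"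
  shows "vsort M x \<in> tsorts M"
  using assms(2-)
proof (induction u)
  case (Var y)
  then show ?case by simp
next
  case (Fun f ts)
  then obtain u where u: "u \<in> set ts" "x \<in> vars_trm u" by auto
  have "sort_of M u \<in> set (asorts M f)"
    using Fun.prems u(1) by (metis image_eqI list.set_map well_sorted.simps(2))
  moreover have "set (asorts M f) \<subseteq> tsorts M"
    using lc_model.theory_syms [OF assms(1)] Fun.prems(1) by auto
  ultimately show ?case using Fun.IH [OF u(1)] Fun.prems u by auto
qed

text \<open>Inclusion of the set of value tuples of \<open>s\<close> in that of \<open>t\<close>;
  tuples are indexed by \<open>P\<close> and never formed explicitly.\<close>

definition covers :: "('s, 'v, 'f) lc_struct \<Rightarrow> pos set \<Rightarrow> ('v, 'f) trm \<Rightarrow> ('v, 'f) ec \<Rightarrow>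
    ('v, 'f) trm \<Rightarrow> ('v, 'f) ec \<Rightarrow> bool" where
  "covers M P s C t D \<longleftrightarrow> (\<forall>\<rho>. valuation M \<rho> \<and> sat_ec M \<rho> C \<longrightarrow>
     (\<exists>\<pi>. valuation M \<pi> \<and> sat_ec M \<pi> D \<and>
          (\<forall>p\<in>P. eval_trm M \<rho> (subt_at s p) = eval_trm M \<pi> (subt_at t p))))"

text \<open>Entailment is a universal statement about value tuples, hence it passes to a smaller
  tuple set: the inclusion runs from \<open>t\<close> to \<open>s\<close>, the entailment from
  \<open>C\<close> to \<open>D\<close>.\<close>

lemma covers_entails_eq:
  assumes "covers M P t D s C"
  shows "p \<in> P \<Longrightarrow> q \<in> P \<Longrightarrow> entails_eq M C (subt_at s p) (subt_at s q) \<Longrightarrow>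
      entails_eq M D (subt_at t p) (subt_at t q)"
    and "p \<in> P \<Longrightarrow> entails_eq M C (subt_at s p) (val v) \<Longrightarrow> entails_eq M D (subt_at t p) (val v)"
proof -
  have *: "\<exists>\<pi>. valuation M \<pi> \<and> sat_ec M \<pi> C \<and>
      (\<forall>p\<in>P. eval_trm M \<rho> (subt_at t p) = eval_trm M \<pi> (subt_at s p))"
    if "valuation M \<rho>" "sat_ec M \<rho> D" for \<rho>
    using assms that by (simp add: covers_def)
  show "entails_eq M D (subt_at t p) (subt_at t q)"
    if "p \<in> P" "q \<in> P" "entails_eq M C (subt_at s p) (subt_at s q)"
    using * that by (fastforce simp: entails_eq_def)
  show "entails_eq M D (subt_at t p) (val v)" if "p \<in> P" "entails_eq M C (subt_at s p) (val v)"
    using * that by (fastforce simp: entails_eq_def)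
qed

context lc_model
begin

lemma carr_rsort:
  "v \<in> Val M \<Longrightarrow>
    v \<in> carr M (rsort M v) \<and> rsort M v \<in> tsorts M \<and> intp M v [] = v \<and> asorts M v = []"
  using value_syms by (auto simp: Val_def)

lemma carr_Val: "\<tau> \<in> tsorts M \<Longrightarrow> v \<in> carr M \<tau> \<Longrightarrow> v \<in> Val M \<and> rsort M v = \<tau>"
  using value_syms by (auto simp: Val_def)

text \<open>Replaces substituted value lists by a change of the valuation on the bound variables.
  The sort assumption ensures that the chosen values are constants evaluating to themselves.\<close>

lemma sat_ec_iff:
  assumes "\<forall>x\<in>set xs. vsort M x \<in> tsorts M"
  shows "sat_ec M \<rho> (xs, \<phi>) \<longleftrightarrow>
    (\<exists>\<rho>'. (\<forall>x. x \<notin> set xs \<longrightarrow> \<rho>' x = \<rho> x) \<and> (\<forall>x\<in>set xs. \<rho>' x \<in> carr M (vsort M x)) \<and>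
          eval_trm M \<rho>' \<phi> = ttS M)"
    (is "_ \<longleftrightarrow> ?R")
proof
  assume "sat_ec M \<rho> (xs, \<phi>)"
  then obtain vs where vs: "list_all2 (\<lambda>x v. v \<in> carr M (vsort M x)) xs vs"
    "eval_trm M \<rho> (subst_trm (assign_vals xs vs) \<phi>) = ttS M"
    by (auto simp: sat_ec_def)
  let ?\<rho> = "\<lambda>x. eval_trm M \<rho> (assign_vals xs vs x)"
  have len: "length xs = length vs" using vs(1) by (rule list_all2_lengthD)
  have "?\<rho> x = \<rho> x" if "x \<notin> set xs" for x
  proof -
    have "map_of (zip xs vs) x = None"
      using that len by (simp add: map_of_zip_is_None)
    then show ?thesis by (simp add: assign_vals_def)
  qed
  moreover have "?\<rho> x \<in> carr M (vsort M x)" if x: "x \<in> set xs" for x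
  proof -
    obtain v where v: "map_of (zip xs vs) x = Some v"
      using x map_of_zip_is_Some [OF len, of x] by auto
    then have "(x, v) \<in> set (zip xs vs)" by (rule map_of_SomeD)
    then have "v \<in> carr M (vsort M x)" using vs(1) by (auto simp: list_all2_iff)
    then show ?thesis using v that assms value_syms by (auto simp: assign_vals_def)
  qed
  ultimately show ?R using vs(2) by (intro exI [of _ ?\<rho>]) (simp add: eval_subst_trm)
next
  assume ?R
  then obtain \<rho>' where \<rho>': "\<And>x. x \<notin> set xs \<Longrightarrow> \<rho>' x = \<rho> x"
    "\<And>x. x \<in> set xs \<Longrightarrow> \<rho>' x \<in> carr M (vsort M x)" "eval_trm M \<rho>' \<phi> = ttS M"
    by blast
  have "eval_trm M \<rho> (assign_vals xs (map \<rho>' xs) x) = \<rho>' x" for x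
  proof (cases "x \<in> set xs")
    case True
    then have "map_of (zip xs (map \<rho>' xs)) x = Some (\<rho>' x)"
      by (simp add: map_of_zip_map)
    then show ?thesis using value_syms [OF _ \<rho>'(2) [OF True]] True assms by (simp add: assign_vals_def)
  next
    case False
    then show ?thesis using \<rho>'(1) by (simp add: assign_vals_def map_of_zip_map)
  qed
  then have "eval_trm M \<rho> (subst_trm (assign_vals xs (map \<rho>' xs)) \<phi>) = ttS M"
    using \<rho>'(3) by (simp add: eval_subst_trm)
  moreover have "list_all2 (\<lambda>x v. v \<in> carr M (vsort M x)) xs (map \<rho>' xs)"
    using \<rho>'(2) by (simp add: list_all2_conv_all_nth)
  ultimately show "sat_ec M \<rho> (xs, \<phi>)" by (auto simp: sat_ec_def)
qed

lemma sat_ec_cong: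
  assumes xs: "\<forall>x\<in>set (fst C). vsort M x \<in> tsorts M"
    and eq: "\<And>x. x \<in> FVar C \<Longrightarrow> \<rho>1 x = \<rho>2 x"
  shows "sat_ec M \<rho>1 C \<longleftrightarrow> sat_ec M \<rho>2 C"
proof -
  have imp: "sat_ec M \<rho> (xs, \<phi>) \<Longrightarrow> sat_ec M \<pi> (xs, \<phi>)"
    if C: "\<forall>x\<in>set xs. vsort M x \<in> tsorts M" and eq: "\<And>x. x \<in> FVar (xs, \<phi>) \<Longrightarrow> \<rho> x = \<pi> x"
    for \<rho> \<pi> xs \<phi>
  proof -
    assume "sat_ec M \<rho> (xs, \<phi>)"
    then obtain \<rho>' where \<rho>': "\<And>x. x \<notin> set xs \<Longrightarrow> \<rho>' x = \<rho> x"
      "\<And>x. x \<in> set xs \<Longrightarrow> \<rho>' x \<in> carr M (vsort M x)" "eval_trm M \<rho>' \<phi> = ttS M"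
      using sat_ec_iff [OF C] by blast
    let ?\<pi> = "\<lambda>x. if x \<in> set xs then \<rho>' x else \<pi> x"
    have "eval_trm M \<rho>' \<phi> = eval_trm M ?\<pi> \<phi>"
      using eq \<rho>'(1) by (intro eval_trm_cong) (auto simp: FVar_def)
    then show "sat_ec M \<pi> (xs, \<phi>)"
      unfolding sat_ec_iff [OF C] using \<rho>' by (intro exI [of _ ?\<pi>]) auto
  qed
  obtain xs \<phi> where "C = (xs, \<phi>)" by (cases C)
  then show ?thesis using imp [of xs \<phi> \<rho>1 \<rho>2] imp [of xs \<phi> \<rho>2 \<rho>1] assms by auto
qed

text \<open>Makes the choice in \<open>fresh_renaming\<close> meaningful. Each theory sort has
  infinitely many variables, so a fresh one of the right sort can be added at every step.\<close>

lemma fresh_renaming_exists: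
  assumes "finite A" "finite U" "\<forall>x\<in>A. vsort M x \<in> tsorts M"
  shows "\<exists>r. renaming M A (r ` A) r \<and> r ` A \<inter> U = {}"
  using assms
proof (induction A rule: finite_induct)
  case empty
  then show ?case by (auto simp: renaming_def)
next
  case (insert a A)
  then obtain r where r: "renaming M A (r ` A) r" "r ` A \<inter> U = {}" by auto
  have "infinite {x. vsort M x = vsort M a}" using insert.prems fresh_vars by simp
  moreover have "finite (U \<union> r ` A)" using insert by simp
  ultimately obtain b where b: "vsort M b = vsort M a" "b \<notin> U \<union> r ` A"
    by (metis (mono_tags, lifting) mem_Collect_eq rev_finite_subset subsetI)
  let ?r = "r(a := b)"
  have im: "?r ` A = r ` A" using insert.hyps by auto
  have "inj_on r A" using r by (simp add: renaming_def bij_betw_def)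
  then have "inj_on ?r (insert a A)" using b insert.hyps im
    by (auto simp: inj_on_def)
  then have "renaming M (insert a A) (?r ` insert a A) ?r"
    using r b unfolding renaming_def bij_betw_def by auto
  moreover have "?r ` insert a A \<inter> U = {}" using im b r by auto
  ultimately show ?case by blast
qed

text \<open>Substitution lemma for constraints with binders. In both branches of
  \<open>subst_ec\<close> the bound variables avoid the variables of the inserted terms, so changing
  the valuation on the former leaves the latter unaffected. The second claim allows the lemma to be
  iterated, as needed for \<open>\<mu>\<close> followed by the restricted relation.\<close>

lemma sat_subst_ec:
  assumes xs: "\<forall>x\<in>set (fst C). vsort M x \<in> tsorts M"
  shows "sat_ec M \<rho> (subst_ec M \<sigma> C) \<longleftrightarrow> sat_ec M (\<lambda>x. eval_trm M \<rho> (\<sigma> x)) C"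
    and "\<forall>x\<in>set (fst (subst_ec M \<sigma> C)). vsort M x \<in> tsorts M"
proof -
  obtain xs \<phi> where C: "C = (xs, \<phi>)" by (cases C)
  have sorts: "\<forall>x\<in>set xs. vsort M x \<in> tsorts M" using xs C by simp
  let ?F = "FVar (xs, \<phi>)"
  let ?U = "\<Union>x\<in>?F. vars_trm (\<sigma> x)"
  let ?\<pi> = "\<lambda>x. eval_trm M \<rho> (\<sigma> x)"
  have F: "?F = vars_trm \<phi> - set xs" by (simp add: FVar_def)
  have "(sat_ec M \<rho> (subst_ec M \<sigma> C) \<longleftrightarrow> sat_ec M ?\<pi> C) \<and>
    (\<forall>x\<in>set (fst (subst_ec M \<sigma> C)). vsort M x \<in> tsorts M)"
  proof (cases "set xs \<inter> ?U = {}")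
    case True
    then have sub: "subst_ec M \<sigma> C = (xs, subst_trm (restrict_subst \<sigma> ?F) \<phi>)"
      by (simp add: subst_ec_def C Let_def)
    have ev: "eval_trm M \<rho>' (subst_trm (restrict_subst \<sigma> ?F) \<phi>) =
        eval_trm M (\<lambda>x. if x \<in> set xs then \<rho>' x else ?\<pi> x) \<phi>"
      if "\<And>x. x \<notin> set xs \<Longrightarrow> \<rho>' x = \<rho> x" for \<rho>'
      unfolding eval_subst_trm
    proof (rule eval_trm_cong)
      fix x assume x: "x \<in> vars_trm \<phi>"
      show "eval_trm M \<rho>' (restrict_subst \<sigma> ?F x) = (if x \<in> set xs then \<rho>' x else ?\<pi> x)"
      proof (cases "x \<in> set xs")
        case True
        then show ?thesis by (simp add: restrict_subst_def F)
      next
        case False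
        then have "x \<in> ?F" using x F by simp
        moreover from this have "eval_trm M \<rho>' (\<sigma> x) = ?\<pi> x"
          using True that by (intro eval_trm_cong) auto
        ultimately show ?thesis using False by (simp add: restrict_subst_def)
      qed
    qed
    have "sat_ec M \<rho> (subst_ec M \<sigma> C) \<longleftrightarrow> sat_ec M ?\<pi> C"
    proof
      assume "sat_ec M \<rho> (subst_ec M \<sigma> C)"
      then obtain \<rho>' where \<rho>': "\<And>x. x \<notin> set xs \<Longrightarrow> \<rho>' x = \<rho> x"
        "\<And>x. x \<in> set xs \<Longrightarrow> \<rho>' x \<in> carr M (vsort M x)"
        "eval_trm M \<rho>' (subst_trm (restrict_subst \<sigma> ?F) \<phi>) = ttS M"
        unfolding sub sat_ec_iff [OF sorts] by blast
      then show "sat_ec M ?\<pi> C"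
        unfolding C sat_ec_iff [OF sorts] using ev [of \<rho>']
        by (intro exI [of _ "\<lambda>x. if x \<in> set xs then \<rho>' x else ?\<pi> x"]) auto
    next
      assume "sat_ec M ?\<pi> C"
      then obtain \<rho>' where \<rho>': "\<And>x. x \<notin> set xs \<Longrightarrow> \<rho>' x = ?\<pi> x"
        "\<And>x. x \<in> set xs \<Longrightarrow> \<rho>' x \<in> carr M (vsort M x)" "eval_trm M \<rho>' \<phi> = ttS M"
        unfolding C sat_ec_iff [OF sorts] by blast
      let ?\<rho> = "\<lambda>x. if x \<in> set xs then \<rho>' x else \<rho> x"
      have "eval_trm M ?\<rho> (subst_trm (restrict_subst \<sigma> ?F) \<phi>) = ttS M"
        using ev [of ?\<rho>] \<rho>' eval_trm_cong [of \<phi> "\<lambda>x. if x \<in> set xs then ?\<rho> x else ?\<pi> x" \<rho>' M] by auto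
      then show "sat_ec M \<rho> (subst_ec M \<sigma> C)"
        unfolding sub sat_ec_iff [OF sorts] using \<rho>' by (intro exI [of _ ?\<rho>]) auto
    qed
    then show ?thesis using sub sorts by simp
  next
    case False
    define r where "r = fresh_renaming M (set xs) (?U \<union> vars_trm \<phi>)"
    have "finite (?U \<union> vars_trm \<phi>)" by (simp add: F finite_vars_trm)
    then have "\<exists>r. renaming M (set xs) (r ` set xs) r \<and> r ` set xs \<inter> (?U \<union> vars_trm \<phi>) = {}"
      by (rule fresh_renaming_exists [OF finite_set]) (rule sorts)
    then have r: "renaming M (set xs) (r ` set xs) r \<and> r ` set xs \<inter> (?U \<union> vars_trm \<phi>) = {}"
      unfolding r_def fresh_renaming_def by (rule someI_ex)
    then have inj: "inj_on r (set xs)" and rs: "\<And>x. x \<in> set xs \<Longrightarrow> vsort M (r x) = vsort M x"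
      by (auto simp: renaming_def bij_betw_def)
    let ?\<tau> = "\<lambda>x. if x \<in> ?F then \<sigma> x else Var (r x)"
    have sub: "subst_ec M \<sigma> C = (map r xs, subst_trm ?\<tau> \<phi>)"
      unfolding r_def using False by (simp add: subst_ec_def C Let_def)
    have sorts': "\<forall>x\<in>set (map r xs). vsort M x \<in> tsorts M" using sorts rs by auto
    have ev: "eval_trm M \<rho>' (subst_trm ?\<tau> \<phi>) =
        eval_trm M (\<lambda>x. if x \<in> set xs then \<rho>' (r x) else ?\<pi> x) \<phi>"
      if "\<And>x. x \<notin> r ` set xs \<Longrightarrow> \<rho>' x = \<rho> x" for \<rho>'
      unfolding eval_subst_trm
    proof (rule eval_trm_cong)
      fix x assume x: "x \<in> vars_trm \<phi>"
      show "eval_trm M \<rho>' (?\<tau> x) = (if x \<in> set xs then \<rho>' (r x) else ?\<pi> x)"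
      proof (cases "x \<in> set xs")
        case True
        then show ?thesis by (simp add: F)
      next
        case False
        then have "x \<in> ?F" using x F by simp
        moreover from this have "eval_trm M \<rho>' (\<sigma> x) = ?\<pi> x"
          using r that by (intro eval_trm_cong) auto
        ultimately show ?thesis using False by simp
      qed
    qed
    have "sat_ec M \<rho> (subst_ec M \<sigma> C) \<longleftrightarrow> sat_ec M ?\<pi> C"
    proof
      assume "sat_ec M \<rho> (subst_ec M \<sigma> C)"
      then obtain \<rho>' where \<rho>': "\<And>x. x \<notin> set (map r xs) \<Longrightarrow> \<rho>' x = \<rho> x"
        "\<And>x. x \<in> set (map r xs) \<Longrightarrow> \<rho>' x \<in> carr M (vsort M x)"
        "eval_trm M \<rho>' (subst_trm ?\<tau> \<phi>) = ttS M"
        unfolding sub sat_ec_iff [OF sorts'] by blast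
      have "\<rho>' (r x) \<in> carr M (vsort M x)" if "x \<in> set xs" for x
        using \<rho>'(2) [of "r x"] rs that by simp
      then show "sat_ec M ?\<pi> C"
        unfolding C sat_ec_iff [OF sorts] using ev [of \<rho>'] \<rho>'
        by (intro exI [of _ "\<lambda>x. if x \<in> set xs then \<rho>' (r x) else ?\<pi> x"]) auto
    next
      assume "sat_ec M ?\<pi> C"
      then obtain \<rho>' where \<rho>': "\<And>x. x \<notin> set xs \<Longrightarrow> \<rho>' x = ?\<pi> x"
        "\<And>x. x \<in> set xs \<Longrightarrow> \<rho>' x \<in> carr M (vsort M x)" "eval_trm M \<rho>' \<phi> = ttS M"
        unfolding C sat_ec_iff [OF sorts] by blast
      \<comment> \<open>The witnesses for the bound variables are moved to their fresh names;
        injectivity of \<open>r\<close> makes this well defined.\<close>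
      let ?\<rho> = "\<lambda>x. if x \<in> r ` set xs then \<rho>' (the_inv_into (set xs) r x) else \<rho> x"
      have \<rho>r: "?\<rho> (r x) = \<rho>' x" if "x \<in> set xs" for x
        using that by (simp add: the_inv_into_f_f [OF inj])
      have "eval_trm M ?\<rho> (subst_trm ?\<tau> \<phi>) =
          eval_trm M (\<lambda>x. if x \<in> set xs then ?\<rho> (r x) else ?\<pi> x) \<phi>"
        by (rule ev) simp
      also have "\<dots> = eval_trm M \<rho>' \<phi>"
        using \<rho>r \<rho>'(1) by (intro eval_trm_cong) auto
      finally have "eval_trm M ?\<rho> (subst_trm ?\<tau> \<phi>) = ttS M" using \<rho>'(3) by simp
      moreover have "?\<rho> x \<in> carr M (vsort M x)" if "x \<in> set (map r xs)" for x
        using that \<rho>r \<rho>'(2) rs by force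
      ultimately show "sat_ec M \<rho> (subst_ec M \<sigma> C)"
        unfolding sub sat_ec_iff [OF sorts'] by (intro exI [of _ ?\<rho>]) auto
    qed
    then show ?thesis using sub sorts' by simp
  qed
  then show "sat_ec M \<rho> (subst_ec M \<sigma> C) \<longleftrightarrow> sat_ec M ?\<pi> C"
    and "\<forall>x\<in>set (fst (subst_ec M \<sigma> C)). vsort M x \<in> tsorts M" by blast+
qed


lemma ex_constrained_termD:
  assumes "ex_constrained_term M (X, s, C)"
  shows "\<forall>x\<in>X. vsort M x \<in> tsorts M" "well_sorted M s" "FVar C \<subseteq> X" "X \<subseteq> vars_trm s"
    "\<forall>x\<in>set (fst C). vsort M x \<in> tsorts M"
proof -
  obtain xs \<phi> where C: "C = (xs, \<phi>)" by (cases C)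
  show "\<forall>x\<in>X. vsort M x \<in> tsorts M" "well_sorted M s" "FVar C \<subseteq> X" "X \<subseteq> vars_trm s"
    using assms by (auto simp: ex_constrained_term_def)
  have "logical_constraint M \<phi>" "set xs \<subseteq> vars_trm \<phi>"
    using assms by (auto simp: ex_constrained_term_def ex_constraint_def C)
  then show "\<forall>x\<in>set (fst C). vsort M x \<in> tsorts M"
    using theory_trm_vars [OF lc_model_axioms, of \<phi>] bool(1) C
    by (auto simp: logical_constraint_def)
qed

text \<open>A value symbol has no argument sorts, so in a well-sorted term it occurs without
  arguments.\<close>

lemma posXV_cases:
  assumes "well_sorted M s" "p \<in> posXV M X s"
  obtains x where "x \<in> X" "subt_at s p = Var x" | v where "v \<in> Val M" "subt_at s p = val v"
proof (cases "subt_at s p")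
  case (Var x)
  then show ?thesis using assms that by (auto simp: posXV_def)
next
  case (Fun f ts)
  then have f: "f \<in> Val M" using assms by (auto simp: posXV_def)
  have "well_sorted M (Fun f ts)"
    using well_sorted_subt_at [of M s p] assms Fun by (simp add: posXV_def)
  then have "ts = []" using carr_rsort [OF f] by simp
  then show ?thesis using that(2) f Fun by simp
qed

section \<open>Subsumption and value tuples\<close>

text \<open>On \<open>X\<close>, which contains all free variables of \<open>C\<close>, \<sigma> is
  the solution \<rho> written as constants; therefore no further valuation affects the instantiated
  constraint. The freedom of \<tau> elsewhere serves both the identity and a transported
  substitution.\<close>

lemma models_ec_value_subst:
  assumes S: "ex_constrained_term M (X, s, C)" and \<rho>: "valuation M \<rho>" "sat_ec M \<rho> C"
    and \<tau>: "substitution M \<tau>"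
  defines "\<sigma> \<equiv> \<lambda>x. if x \<in> X then val (\<rho> x) else \<tau> x"
  shows "substitution M \<sigma>" "valued M X \<sigma>" "models_ec M \<sigma> C"
proof -
  note S = ex_constrained_termD [OF S]
  have X: "\<rho> x \<in> Val M \<and> rsort M (\<rho> x) = vsort M x \<and> asorts M (\<rho> x) = [] \<and> intp M (\<rho> x) [] = \<rho> x"
    if "x \<in> X" for x
  proof -
    have "\<rho> x \<in> carr M (vsort M x)" using \<rho>(1) S(1) that by (simp add: valuation_def)
    then show ?thesis using carr_Val [of "vsort M x" "\<rho> x"] carr_rsort [of "\<rho> x"] S(1) that by simp
  qed
  then show "substitution M \<sigma>" using \<tau> by (auto simp: substitution_def \<sigma>_def)
  show "valued M X \<sigma>" using X by (auto simp: valued_def \<sigma>_def)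
  then have "valued M (FVar C) \<sigma>" using S(3) by (auto simp: valued_def)
  moreover have "sat_ec M \<pi> (subst_ec M \<sigma> C)" for \<pi>
  proof -
    have "sat_ec M (\<lambda>x. eval_trm M \<pi> (\<sigma> x)) C \<longleftrightarrow> sat_ec M \<rho> C"
      using S(3) X by (intro sat_ec_cong [OF S(5)]) (auto simp: \<sigma>_def)
    then show ?thesis using \<rho>(2) by (simp add: sat_subst_ec(1) [OF S(5)])
  qed
  ultimately show "models_ec M \<sigma> C" by (simp add: models_ec_def)
qed

lemma valuation_of_models_ec:
  assumes S: "ex_constrained_term M (X, s, C)"
    and \<sigma>: "substitution M \<sigma>" "valued M X \<sigma>" "models_ec M \<sigma> C" and \<rho>0: "valuation M \<rho>0"
  obtains \<rho> where "valuation M \<rho>" "sat_ec M \<rho> C" "\<forall>x\<in>X. \<sigma> x = val (\<rho> x)"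
proof
  note S = ex_constrained_termD [OF S]
  \<comment> \<open>On \<open>X\<close> the result is independent of \<rho>0, as \<sigma> gives
    values there; outside \<open>X\<close>, \<rho>0 only supplies elements of the carriers.\<close>
  let ?\<rho> = "\<lambda>x. if x \<in> X then eval_trm M \<rho>0 (\<sigma> x) else \<rho>0 x"
  have X: "\<sigma> x = val (?\<rho> x) \<and> ?\<rho> x \<in> carr M (vsort M x)" if x: "x \<in> X" for x
  proof -
    obtain v where v: "v \<in> Val M" "\<sigma> x = val v" using \<sigma>(2) x by (auto simp: valued_def)
    moreover have "rsort M v = vsort M x" using \<sigma>(1) v(2) by (metis substitution_def sort_of.simps(2))
    ultimately show ?thesis using carr_rsort [OF v(1)] x by simp
  qed
  then show "\<forall>x\<in>X. \<sigma> x = val (?\<rho> x)" by blast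
  show "valuation M ?\<rho>" using X \<rho>0 by (auto simp: valuation_def)
  have "sat_ec M (\<lambda>x. eval_trm M \<rho>0 (\<sigma> x)) C"
    using \<sigma>(3) \<rho>0 by (simp add: models_ec_def sat_subst_ec(1) [OF S(5)])
  moreover have "sat_ec M (\<lambda>x. eval_trm M \<rho>0 (\<sigma> x)) C \<longleftrightarrow> sat_ec M ?\<rho> C"
    using S(3) by (intro sat_ec_cong [OF S(5)]) auto
  ultimately show "sat_ec M ?\<rho> C" by simp
qed

lemma eval_posXV:
  assumes "ex_constrained_term M (X, s, C)" "valuation M \<rho>" "p \<in> posXV M X s"
  shows "eval_trm M \<rho> (subt_at s p) \<in> carr M (sort_of M (subt_at s p))"
    and "sort_of M (subt_at s p) \<in> tsorts M"
    and "(\<And>x. x \<in> X \<Longrightarrow> \<sigma> x = val (\<rho> x)) \<Longrightarrow>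
      subst_trm \<sigma> (subt_at s p) = val (eval_trm M \<rho> (subt_at s p))"
proof -
  note S = ex_constrained_termD [OF assms(1)]
  have "eval_trm M \<rho> (subt_at s p) \<in> carr M (sort_of M (subt_at s p)) \<and>
    sort_of M (subt_at s p) \<in> tsorts M \<and> ((\<forall>x\<in>X. \<sigma> x = val (\<rho> x)) \<longrightarrow>
      subst_trm \<sigma> (subt_at s p) = val (eval_trm M \<rho> (subt_at s p)))"
    using S(2) assms(3)
  proof (cases rule: posXV_cases)
    case (1 x)
    then show ?thesis using S(1) assms(2) by (simp add: valuation_def)
  next
    case (2 v)
    then show ?thesis using carr_rsort [of v] by simp
  qed
  then show "eval_trm M \<rho> (subt_at s p) \<in> carr M (sort_of M (subt_at s p))"
    and "sort_of M (subt_at s p) \<in> tsorts M"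
    and "(\<And>x. x \<in> X \<Longrightarrow> \<sigma> x = val (\<rho> x)) \<Longrightarrow>
      subst_trm \<sigma> (subt_at s p) = val (eval_trm M \<rho> (subt_at s p))" by blast+
qed

text \<open>A substitution that keeps the variables outside \<open>X\<close> can create a value only
  by replacing a variable of \<open>X\<close>; any other value is already a symbol of
  \<open>s\<close>.\<close>

lemma posXV_if_value:
  assumes "p \<in> poss (subst_trm \<sigma> s)" "root (subt_at (subst_trm \<sigma> s) p) \<in> Inr ` Val M"
    and X: "\<And>x. x \<in> X \<Longrightarrow> \<sigma> x = val (\<rho> x)" and nX: "\<And>x. x \<notin> X \<Longrightarrow> \<sigma> x = Var x"
  shows "p \<in> posXV M X s"
  using assms(1)
proof (cases rule: poss_subst_trm_cases)
  case 1
  then have "root (subst_trm \<sigma> (subt_at s p)) \<in> Inr ` Val M"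
    using assms(2) subt_at_subst_trm by metis
  moreover have "root (subt_at s p) \<in> Inl ` X \<union> Inr ` Val M" if "root (subst_trm \<sigma> (subt_at s p)) \<in> Inr ` Val M"
    using that nX by (cases "subt_at s p"; cases "\<exists>x. subt_at s p = Var x \<and> x \<notin> X") auto
  ultimately show ?thesis using 1 by (simp add: posXV_def)
next
  case (2 q r x)
  have r: "r = []" using 2(4) X nX by (cases "x \<in> X") auto
  have "subt_at (subst_trm \<sigma> s) p = \<sigma> x"
    using 2 r subt_at_subst_trm [of q s \<sigma>] by simp
  then have "x \<in> X" using assms(2) nX by (cases "x \<in> X") auto
  then show ?thesis using 2 r by (simp add: posXV_def)
qed

text \<open>The test instance behind all necessary conditions: keeping the variables outside
  \<open>X\<close> makes them visible in the instance and distinguishable from values.\<close>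

lemma subsumed_instance:
  assumes S: "ex_constrained_term M (X, s, C)" and T: "ex_constrained_term M (Y, t, D)"
    and sub: "subsumed M (X, s, C) (Y, t, D)" and \<rho>: "valuation M \<rho>" "sat_ec M \<rho> C"
  obtains \<gamma> \<pi> where "substitution M \<gamma>" "valuation M \<pi>" "sat_ec M \<pi> D" "\<forall>y\<in>Y. \<gamma> y = val (\<pi> y)"
    "subst_trm (\<lambda>x. if x \<in> X then val (\<rho> x) else Var x) s = subst_trm \<gamma> t"
proof -
  have "substitution M Var" by (simp add: substitution_def)
  note \<sigma> = models_ec_value_subst [OF S \<rho> this]
  obtain \<gamma> where \<gamma>: "substitution M \<gamma>" "valued M Y \<gamma>" "models_ec M \<gamma> D"
    "subst_trm (\<lambda>x. if x \<in> X then val (\<rho> x) else Var x) s = subst_trm \<gamma> t"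
    using sub \<sigma> unfolding subsumed_def by blast
  obtain \<pi> where "valuation M \<pi>" "sat_ec M \<pi> D" "\<forall>y\<in>Y. \<gamma> y = val (\<pi> y)"
    using valuation_of_models_ec [OF T \<gamma>(1-3) \<rho>(1)] by blast
  then show ?thesis using that \<gamma>(1,4) by blast
qed

text \<open>Every position in \<open>posXV M Y t\<close> shows a value in the matching instance of
  \<open>t\<close>, and in the test instance of \<open>s\<close> values appear only at positions of
  \<open>posXV M X s\<close>.\<close>

lemma subsumed_posXV:
  assumes S: "ex_constrained_term M (X, s, C)" and T: "ex_constrained_term M (Y, t, D)"
    and sub: "subsumed M (X, s, C) (Y, t, D)" and "satisfiable M C"
  shows "posXV M Y t \<subseteq> posXV M X s"
proof
  fix p assume p: "p \<in> posXV M Y t"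
  obtain \<rho> where \<rho>: "valuation M \<rho>" "sat_ec M \<rho> C" using assms(4) by (auto simp: satisfiable_def)
  obtain \<gamma> \<pi> where \<gamma>: "valuation M \<pi>" "\<forall>y\<in>Y. \<gamma> y = val (\<pi> y)"
    and eq: "subst_trm (\<lambda>x. if x \<in> X then val (\<rho> x) else Var x) s = subst_trm \<gamma> t"
    using subsumed_instance [OF S T sub \<rho>] by blast
  have pt: "p \<in> poss t" using p by (simp add: posXV_def)
  have "subt_at (subst_trm \<gamma> t) p = val (eval_trm M \<pi> (subt_at t p))"
    using eval_posXV(3) [OF T \<gamma>(1) p \<gamma>(2)[rule_format]] subt_at_subst_trm [OF pt, of \<gamma>] by simp
  moreover have "eval_trm M \<pi> (subt_at t p) \<in> Val M"
    using eval_posXV(1,2) [OF T \<gamma>(1) p] carr_Val by blast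
  ultimately have "root (subt_at (subst_trm (\<lambda>x. if x \<in> X then val (\<rho> x) else Var x) s) p) \<in> Inr ` Val M"
    using eq by simp
  moreover have "p \<in> poss (subst_trm (\<lambda>x. if x \<in> X then val (\<rho> x) else Var x) s)"
    using eq subt_at_subst_trm [OF pt, of \<gamma>] by simp
  ultimately show "p \<in> posXV M X s"
    using posXV_if_value [of p "\<lambda>x. if x \<in> X then val (\<rho> x) else Var x" s X \<rho>] by simp
qed

lemma subsumed_covers:
  assumes S: "ex_constrained_term M (X, s, C)" and T: "ex_constrained_term M (Y, t, D)"
    and sub: "subsumed M (X, s, C) (Y, t, D)" and P: "posXV M X s = posXV M Y t"
  shows "covers M (posXV M X s) s C t D"
  unfolding covers_def
proof (intro allI impI)
  fix \<rho> assume \<rho>: "valuation M \<rho> \<and> sat_ec M \<rho> C"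
  obtain \<gamma> \<pi> where \<gamma>: "valuation M \<pi>" "sat_ec M \<pi> D" "\<forall>y\<in>Y. \<gamma> y = val (\<pi> y)"
    and eq: "subst_trm (\<lambda>x. if x \<in> X then val (\<rho> x) else Var x) s = subst_trm \<gamma> t"
    using subsumed_instance [OF S T sub conjunct1 [OF \<rho>] conjunct2 [OF \<rho>]] by blast
  have "eval_trm M \<rho> (subt_at s p) = eval_trm M \<pi> (subt_at t p)" if p: "p \<in> posXV M X s" for p
  proof -
    have pos: "p \<in> poss s" "p \<in> poss t" using p P by (auto simp: posXV_def)
    have "subst_trm (\<lambda>x. if x \<in> X then val (\<rho> x) else Var x) (subt_at s p) = subst_trm \<gamma> (subt_at t p)"
      using arg_cong [OF eq, of "\<lambda>u. subt_at u p"] by (simp add: subt_at_subst_trm pos)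
    moreover have "subst_trm (\<lambda>x. if x \<in> X then val (\<rho> x) else Var x) (subt_at s p) =
        val (eval_trm M \<rho> (subt_at s p))"
      using \<rho> by (intro eval_posXV(3) [OF S _ p]) auto
    moreover have "subst_trm \<gamma> (subt_at t p) = val (eval_trm M \<pi> (subt_at t p))"
      using \<gamma> p P by (intro eval_posXV(3) [OF T]) auto
    ultimately show ?thesis by simp
  qed
  then show "\<exists>\<pi>. valuation M \<pi> \<and> sat_ec M \<pi> D \<and>
      (\<forall>p\<in>posXV M X s. eval_trm M \<rho> (subt_at s p) = eval_trm M \<pi> (subt_at t p))"
    using \<gamma> by blast
qed

text \<open>Both subsumptions are needed at once: by \<open>variable_position\<close>, the matching
  substitutions \<gamma> and \<gamma>' send variables outside \<open>Y\<close> and \<open>X\<close>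
  to one another and are mutually inverse there.\<close>

lemma subsumed_renaming:
  assumes S: "ex_constrained_term M (X, s, C)" "satisfiable M C"
    and T: "ex_constrained_term M (Y, t, D)" "satisfiable M D"
    and sub: "subsumed M (X, s, C) (Y, t, D)" "subsumed M (Y, t, D) (X, s, C)"
    and P: "P = posXV M X s" "P = posXV M Y t"
  shows "\<exists>r. renaming M (vars_trm s - X) (vars_trm t - Y) r \<and>
    map_mctxt r id (mctxt_of P s) = mctxt_of P t"
proof -
  obtain \<rho>1 where \<rho>1: "valuation M \<rho>1" "sat_ec M \<rho>1 C" using S(2) by (auto simp: satisfiable_def)
  obtain \<gamma> \<pi>1 where \<gamma>: "substitution M \<gamma>" "\<forall>y\<in>Y. \<gamma> y = val (\<pi>1 y)"
    and eq1: "subst_trm (\<lambda>x. if x \<in> X then val (\<rho>1 x) else Var x) s = subst_trm \<gamma> t"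
    using subsumed_instance [OF S(1) T(1) sub(1) \<rho>1] by blast
  obtain \<rho>2 where \<rho>2: "valuation M \<rho>2" "sat_ec M \<rho>2 D" using T(2) by (auto simp: satisfiable_def)
  obtain \<gamma>' \<pi>2 where \<gamma>': "substitution M \<gamma>'" "\<forall>x\<in>X. \<gamma>' x = val (\<pi>2 x)"
    and eq2: "subst_trm (\<lambda>x. if x \<in> Y then val (\<rho>2 x) else Var x) t = subst_trm \<gamma>' s"
    using subsumed_instance [OF T(1) S(1) sub(2) \<rho>2] by blast
  have st: "\<exists>y. y \<notin> Y \<and> p \<in> poss t \<and> subt_at t p = Var y \<and> \<gamma> y = Var x \<and> \<gamma>' x = Var y"
    if "p \<in> poss s" "subt_at s p = Var x" "x \<notin> X" for p x
    by (rule variable_position [OF eq1 eq2 _ _ \<gamma>(2)[rule_format] that]) auto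
  have ts: "\<exists>x. x \<notin> X \<and> p \<in> poss s \<and> subt_at s p = Var x \<and> \<gamma>' x = Var y \<and> \<gamma> y = Var x"
    if "p \<in> poss t" "subt_at t p = Var y" "y \<notin> Y" for p y
    by (rule variable_position [OF eq2 eq1 _ _ \<gamma>'(2)[rule_format] that]) auto
  \<comment> \<open>The renaming is read off the matching substitutions themselves, which also makes
    it sort-preserving.\<close>
  let ?r = "\<lambda>x. THE y. \<gamma>' x = Var y"
  let ?r' = "\<lambda>y. THE x. \<gamma> y = Var x"
  have "bij_betw ?r (vars_trm s - X) (vars_trm t - Y)"
  proof (rule bij_betw_byWitness [where f' = ?r'])
    show "\<forall>x\<in>vars_trm s - X. ?r' (?r x) = x"
      using st by (fastforce simp: vars_trm_subt_at)
    show "\<forall>y\<in>vars_trm t - Y. ?r (?r' y) = y"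
      using ts by (fastforce simp: vars_trm_subt_at)
    show "?r ` (vars_trm s - X) \<subseteq> vars_trm t - Y"
      using st by (fastforce simp: vars_trm_subt_at)
    show "?r' ` (vars_trm t - Y) \<subseteq> vars_trm s - X"
      using ts by (fastforce simp: vars_trm_subt_at)
  qed
  moreover have "vsort M (?r x) = vsort M x" if x: "x \<in> vars_trm s - X" for x
  proof -
    obtain p where "p \<in> poss s" "subt_at s p = Var x" using x by (auto simp: vars_trm_subt_at)
    then obtain y where y: "\<gamma>' x = Var y" using st x by blast
    then have "vsort M y = vsort M x" using \<gamma>'(1) unfolding substitution_def by (metis sort_of.simps(1))
    then show ?thesis using y by simp
  qed
  moreover have "map_mctxt ?r id (mctxt_of P s) = mctxt_of P t"
  proof (rule mctxt_of_eqI [OF eq1])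
    fix p x assume "p \<in> poss s" "p \<notin> P" "subt_at s p = Var x"
    moreover from this have "x \<notin> X" using P(1) by (auto simp: posXV_def)
    ultimately show "subt_at t p = Var (?r x)" using st [of p x] by auto
  next
    fix p y assume "p \<in> poss t" "p \<notin> P" "subt_at t p = Var y"
    moreover from this have "y \<notin> Y" using P(2) by (auto simp: posXV_def)
    ultimately show "\<exists>x. subt_at s p = Var x" using ts [of p y] by auto
  qed
  ultimately show ?thesis unfolding renaming_def by blast
qed

lemma subsumedI:
  assumes S: "ex_constrained_term M (X, s, C)" and T: "ex_constrained_term M (Y, t, D)" "satisfiable M D"
    and r: "renaming M (vars_trm s - X) (vars_trm t - Y) r"
      "map_mctxt r id (mctxt_of P s) = mctxt_of P t"
    and P: "P = posXV M X s" "P = posXV M Y t"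
    and cov: "covers M P s C t D"
  shows "subsumed M (X, s, C) (Y, t, D)"
  unfolding subsumed_def split
proof (intro allI impI, elim conjE)
  fix \<sigma> assume \<sigma>: "substitution M \<sigma>" "valued M X \<sigma>" "models_ec M \<sigma> C"
  obtain \<rho>0 where \<rho>0: "valuation M \<rho>0" using T(2) by (auto simp: satisfiable_def)
  obtain \<rho> where \<rho>: "valuation M \<rho>" "sat_ec M \<rho> C" "\<forall>x\<in>X. \<sigma> x = val (\<rho> x)"
    using valuation_of_models_ec [OF S \<sigma> \<rho>0] by blast
  then obtain \<pi> where \<pi>: "valuation M \<pi>" "sat_ec M \<pi> D"
    "\<And>p. p \<in> P \<Longrightarrow> eval_trm M \<rho> (subt_at s p) = eval_trm M \<pi> (subt_at t p)"
    using cov by (auto simp: covers_def)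
  have bij: "bij_betw r (vars_trm s - X) (vars_trm t - Y)" using r by (simp add: renaming_def)
  let ?i = "the_inv_into (vars_trm s - X) r"
  \<comment> \<open>Outside \<open>Y\<close> the matching substitution must imitate \<sigma> through
    the inverse renaming; on \<open>Y\<close> it takes the values of the solution provided by
    \<open>covers\<close>.\<close>
  let ?\<tau> = "\<lambda>y. if y \<in> vars_trm t - Y then \<sigma> (?i y) else Var y"
  let ?\<gamma> = "\<lambda>y. if y \<in> Y then val (\<pi> y) else ?\<tau> y"
  have "vsort M (?i y) = vsort M y" if "y \<in> vars_trm t - Y" for y
  proof -
    have "?i y \<in> vars_trm s - X" "r (?i y) = y"
      using bij_betw_the_inv_into [OF bij] f_the_inv_into_f_bij_betw [OF bij] that
      by (auto simp: bij_betw_def)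
    then show ?thesis using r(1) unfolding renaming_def by metis
  qed
  then have "substitution M ?\<tau>" using \<sigma>(1) by (auto simp: substitution_def)
  note \<gamma> = models_ec_value_subst [OF T(1) \<pi>(1,2) this]
  have "subst_trm \<sigma> s = subst_trm ?\<gamma> t"
  proof (rule subst_trm_eqI_mctxt_of [OF r(2)])
    fix p assume p: "p \<in> P"
    have "subst_trm \<sigma> (subt_at s p) = val (eval_trm M \<rho> (subt_at s p))"
      using p P(1) \<rho> by (intro eval_posXV(3) [OF S]) auto
    moreover have "subst_trm ?\<gamma> (subt_at t p) = val (eval_trm M \<pi> (subt_at t p))"
      using p P(2) \<pi> by (intro eval_posXV(3) [OF T(1)]) auto
    ultimately show "subst_trm \<sigma> (subt_at s p) = subst_trm ?\<gamma> (subt_at t p)"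
      using \<pi>(3) [OF p] by simp
  next
    fix p x assume p: "p \<in> poss s" "p \<notin> P" "subt_at s p = Var x"
    then have x: "x \<in> vars_trm s - X" using P(1) by (auto simp: posXV_def vars_trm_subt_at)
    then have "r x \<in> vars_trm t - Y" using bij by (auto simp: bij_betw_def)
    moreover have "?i (r x) = x" using x bij by (simp add: bij_betw_def the_inv_into_f_f)
    ultimately show "\<sigma> x = ?\<gamma> (r x)" by simp
  qed
  then show "\<exists>\<gamma>. substitution M \<gamma> \<and> valued M Y \<gamma> \<and> models_ec M \<gamma> D \<and> subst_trm \<sigma> s = subst_trm \<gamma> t"
    using \<gamma> by blast
qed

lemma equivalent_iff_covers:
  assumes S: "ex_constrained_term M (X, s, C)" "satisfiable M C"
    and T: "ex_constrained_term M (Y, t, D)" "satisfiable M D"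
    and P: "P = posXV M X s"
  shows "equivalent M (X, s, C) (Y, t, D) \<longleftrightarrow>
    posXV M X s = posXV M Y t \<and>
    (\<exists>r. renaming M (vars_trm s - X) (vars_trm t - Y) r \<and>
         map_mctxt r id (mctxt_of P s) = mctxt_of P t) \<and>
    covers M P s C t D \<and> covers M P t D s C"
proof
  assume "equivalent M (X, s, C) (Y, t, D)"
  then have sub: "subsumed M (X, s, C) (Y, t, D)" "subsumed M (Y, t, D) (X, s, C)"
    by (auto simp: equivalent_def)
  have eq: "posXV M X s = posXV M Y t"
    using subsumed_posXV [OF S(1) T(1) sub(1) S(2)] subsumed_posXV [OF T(1) S(1) sub(2) T(2)] by blast
  then show "posXV M X s = posXV M Y t \<and>
    (\<exists>r. renaming M (vars_trm s - X) (vars_trm t - Y) r \<and>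
         map_mctxt r id (mctxt_of P s) = mctxt_of P t) \<and>
    covers M P s C t D \<and> covers M P t D s C"
    using subsumed_renaming [OF S T sub P] subsumed_covers [OF S(1) T(1) sub(1)]
      subsumed_covers [OF T(1) S(1) sub(2)] P by simp
next
  assume R: "posXV M X s = posXV M Y t \<and>
    (\<exists>r. renaming M (vars_trm s - X) (vars_trm t - Y) r \<and>
         map_mctxt r id (mctxt_of P s) = mctxt_of P t) \<and>
    covers M P s C t D \<and> covers M P t D s C"
  then obtain r where r: "renaming M (vars_trm s - X) (vars_trm t - Y) r"
    "map_mctxt r id (mctxt_of P s) = mctxt_of P t" and eq: "posXV M X s = posXV M Y t" by blast
  let ?i = "the_inv_into (vars_trm s - X) r"
  have bij: "bij_betw r (vars_trm s - X) (vars_trm t - Y)" using r by (simp add: renaming_def)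
  have inv: "?i (r x) = x" if "x \<in> vars_trm s - X" for x
    using bij that by (simp add: bij_betw_def the_inv_into_f_f)
  have "renaming M (vars_trm t - Y) (vars_trm s - X) ?i"
    unfolding renaming_def
  proof (intro conjI ballI)
    show bi: "bij_betw ?i (vars_trm t - Y) (vars_trm s - X)" by (rule bij_betw_the_inv_into [OF bij])
    fix y assume y: "y \<in> vars_trm t - Y"
    then have "?i y \<in> vars_trm s - X" using bi by (auto simp: bij_betw_def)
    then have "vsort M (r (?i y)) = vsort M (?i y)" using r(1) by (simp add: renaming_def)
    then show "vsort M (?i y) = vsort M y" using f_the_inv_into_f_bij_betw [OF bij] y by simp
  qed
  moreover have "map_mctxt ?i id (mctxt_of P t) = mctxt_of P s"
    using inv P by (intro map_mctxt_mctxt_of_inverse [OF r(2)]) (auto simp: posXV_def vars_trm_subt_at)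
  ultimately show "equivalent M (X, s, C) (Y, t, D)"
    unfolding equivalent_def using R r P eq
    by (auto intro!: subsumedI [OF S(1) T r(1)] subsumedI [OF T(1) S])
qed

end

section \<open>Representative substitutions\<close>

locale rep_term = lc_model M for M :: "('s, 'v, 'f) lc_struct" +
  fixes X :: "'v set" and s :: "('v, 'f) trm" and C :: "('v, 'f) ec" and rep :: "pos \<Rightarrow> pos"
  assumes ect: "ex_constrained_term M (X, s, C)"
    and sat: "satisfiable M C"
    and reps: "representatives M (X, s, C) rep"
begin

abbreviation "P \<equiv> posXV M X s"
abbreviation "V \<equiv> posVal1 M (X, s, C)"
abbreviation "\<mu> \<equiv> rep_subst M rep (X, s, C)"

text \<open>The set written as X with a tilde in condition (5).\<close>

definition rep_vars :: "'v set" where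
  "rep_vars = {x \<in> X. Var x \<in> \<mu> ` X}"

lemmas ectD = ex_constrained_termD [OF ect]

text \<open>A position holding a value symbol is trivially forced to that value, hence belongs to
  \<open>V\<close>.\<close>

lemma not_V_Var:
  assumes "p \<in> P - V"
  obtains x where "x \<in> X" "subt_at s p = Var x"
proof -
  have "p \<in> P" using assms by simp
  with ectD(2) show ?thesis
  proof (cases rule: posXV_cases)
    case (2 v)
    then have "p \<in> V" using assms by (auto simp: posVal1_def entails_eq_def)
    then show ?thesis using assms by simp
  qed (rule that)
qed

lemma X_pos:
  assumes "x \<in> X"
  obtains p where "p \<in> P" "subt_at s p = Var x"
proof -
  have "x \<in> vars_trm s" using assms ectD(4) by blast
  then show ?thesis using that assms by (auto simp: vars_trm_subt_at posXV_def)
qed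

lemma pos_eq_V: "(p, q) \<in> pos_eq M (X, s, C) \<Longrightarrow> p \<in> V \<longleftrightarrow> q \<in> V"
  by (auto simp: pos_eq_def posVal1_def entails_eq_def)

lemma rep_pos_eq: "p \<in> P \<Longrightarrow> (p, rep p) \<in> pos_eq M (X, s, C)"
  using reps by (auto simp: representatives_def)

lemma rep_cong: "(p, q) \<in> pos_eq M (X, s, C) \<Longrightarrow> rep p = rep q"
  using reps by (auto simp: representatives_def)

lemma rep_entails_eq: "p \<in> P \<Longrightarrow> entails_eq M C (subt_at s p) (subt_at s (rep p))"
  using rep_pos_eq by (auto simp: pos_eq_def)

lemma rep_in: "p \<in> P \<Longrightarrow> rep p \<in> P"
  using rep_pos_eq by (auto simp: pos_eq_def)

lemma rep_not_V: "p \<in> P - V \<Longrightarrow> rep p \<in> P - V"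
  using rep_in pos_eq_V rep_pos_eq by blast

lemma rep_rep: "p \<in> P \<Longrightarrow> rep (rep p) = rep p"
  using rep_cong rep_pos_eq by metis

lemma rep_eq_if_same_trm: "p \<in> P \<Longrightarrow> q \<in> P \<Longrightarrow> subt_at s p = subt_at s q \<Longrightarrow> rep p = rep q"
  by (rule rep_cong) (simp add: pos_eq_def entails_eq_def)

lemma V_if_same_trm: "p \<in> P \<Longrightarrow> q \<in> V \<Longrightarrow> subt_at s p = subt_at s q \<Longrightarrow> p \<in> V"
  by (simp add: posVal1_def)

text \<open>Satisfiability gives a solution, and every forced value is the value of the subterm
  under that one solution.\<close>

lemma Val1_entails_eq:
  assumes "p \<in> V"
  shows "Val1 M (X, s, C) p \<in> Val M" "entails_eq M C (subt_at s p) (val (Val1 M (X, s, C) p))"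
proof -
  obtain v where v: "v \<in> Val M" "entails_eq M C (subt_at s p) (val v)"
    using assms by (auto simp: posVal1_def)
  obtain \<rho> where \<rho>: "valuation M \<rho>" "sat_ec M \<rho> C" using sat by (auto simp: satisfiable_def)
  have "w = eval_trm M \<rho> (subt_at s p)" if "w \<in> Val M" "entails_eq M C (subt_at s p) (val w)" for w
    using that \<rho> carr_rsort [of w] by (simp add: entails_eq_def)
  then have "\<exists>!v. v \<in> Val M \<and> entails_eq M C (subt_at s p) (val v)"
    using v by blast
  then have "Val1 M (X, s, C) p \<in> Val M \<and> entails_eq M C (subt_at s p) (val (Val1 M (X, s, C) p))"
    unfolding Val1_def split by (rule theI')
  then show "Val1 M (X, s, C) p \<in> Val M" "entails_eq M C (subt_at s p) (val (Val1 M (X, s, C) p))"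
    by blast+
qed

lemma \<mu>_V:
  assumes "p \<in> V" "subt_at s p = Var x" "x \<in> X"
  obtains v where "v \<in> Val M" "\<mu> x = val v" "entails_eq M C (Var x) (val v)"
proof -
  define q where "q = (SOME p. p \<in> V \<and> subt_at s p = Var x)"
  have q: "q \<in> V \<and> subt_at s q = Var x"
    unfolding q_def by (rule someI [of _ p]) (simp add: assms)
  have "\<exists>p\<in>V. subt_at s p = Var x" using assms by blast
  then have "\<mu> x = val (Val1 M (X, s, C) q)"
    using assms(3) by (simp add: rep_subst_def q_def)
  then show ?thesis using that Val1_entails_eq [of q] q by simp
qed

text \<open>The occurrence of \<open>x\<close> chosen inside \<open>rep_subst\<close> is immaterial:
  all occurrences carry the same term, hence share class and representative.\<close>

lemma \<mu>_not_V:
  assumes "p \<in> P - V" "subt_at s p = Var x" "x \<in> X"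
  shows "\<mu> x = subt_at s (rep p)"
proof -
  define q where "q = (SOME p. p \<in> poss s \<and> subt_at s p = Var x)"
  have q: "q \<in> poss s \<and> subt_at s q = Var x"
    unfolding q_def by (rule someI [of _ p]) (use assms in \<open>simp add: posXV_def\<close>)
  have "\<not> (\<exists>p\<in>V. subt_at s p = Var x)"
    using assms V_if_same_trm [of p] by (metis DiffE)
  then have "\<mu> x = subt_at s (rep q)"
    using assms(3) by (simp add: rep_subst_def q_def)
  moreover have "q \<in> P" using q assms(3) by (simp add: posXV_def)
  ultimately show ?thesis using rep_eq_if_same_trm [of q p] assms q by simp
qed

lemma \<mu>_rep:
  assumes "q \<in> rep ` (P - V)"
  obtains x where "x \<in> X" "subt_at s q = Var x" "\<mu> x = Var x"
proof -
  obtain p where p: "p \<in> P - V" "q = rep p" using assms by blast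
  then have q: "q \<in> P - V" "rep q = q" using rep_not_V rep_rep by auto
  obtain x where "x \<in> X" "subt_at s q = Var x" using not_V_Var [OF q(1)] .
  then show ?thesis using that \<mu>_not_V [OF q(1)] q(2) by simp
qed

text \<open>Forced classes contribute values instead of variables, so only the unforced classes
  leave a variable in the range of \<open>\<mu>\<close>.\<close>

lemma rep_vars_iff: "x \<in> rep_vars \<longleftrightarrow> (\<exists>q\<in>rep ` (P - V). subt_at s q = Var x)"
proof
  assume "x \<in> rep_vars"
  then obtain z where z: "z \<in> X" "\<mu> z = Var x" by (auto simp: rep_vars_def)
  obtain p where p: "p \<in> P" "subt_at s p = Var z" using X_pos [OF z(1)] .
  have "p \<notin> V" using z p by (metis \<mu>_V trm.distinct(1))
  then have "\<mu> z = subt_at s (rep p)" using p z \<mu>_not_V by simp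
  then show "\<exists>q\<in>rep ` (P - V). subt_at s q = Var x"
    using z p \<open>p \<notin> V\<close> by (intro bexI [of _ "rep p"]) auto
next
  assume "\<exists>q\<in>rep ` (P - V). subt_at s q = Var x"
  then obtain q where q: "q \<in> rep ` (P - V)" "subt_at s q = Var x" by blast
  obtain y where "y \<in> X" "subt_at s q = Var y" "\<mu> y = Var y" using \<mu>_rep [OF q(1)] .
  then show "x \<in> rep_vars" using q(2) by (force simp: rep_vars_def)
qed

text \<open>A representative variable may also occur at other positions; these all lie in the class
  of its representative, so passing to \<open>rep p\<close> does not change the variable.\<close>

lemma rep_vars_pos:
  assumes "p \<in> P" "subt_at s p = Var x" "x \<in> rep_vars"
  shows "rep p \<in> rep ` (P - V)" "subt_at s (rep p) = Var x"
proof -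
  obtain p' where p': "p' \<in> P - V" "subt_at s (rep p') = Var x"
    using assms(3) by (auto simp: rep_vars_iff)
  have r: "rep p' \<in> P - V" using p' rep_not_V by blast
  have "rep p = rep (rep p')"
    using rep_eq_if_same_trm [of p "rep p'"] assms p' r by simp
  then have "rep p = rep p'" using rep_rep p' by simp
  then show "rep p \<in> rep ` (P - V)" "subt_at s (rep p) = Var x" using p' by auto
qed

lemma inj_on_rep_positions: "inj_on (subt_at s) (rep ` (P - V))"
proof (rule inj_onI)
  fix q q' assume q: "q \<in> rep ` (P - V)" "q' \<in> rep ` (P - V)" "subt_at s q = subt_at s q'"
  then have "q \<in> P" "q' \<in> P" "rep q = q" "rep q' = q'" using rep_in rep_rep by auto
  then show "q = q'" using rep_eq_if_same_trm q(3) by metis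
qed

lemma bij_betw_rep_positions: "bij_betw (subt_at s) (rep ` (P - V)) (Var ` rep_vars)"
  unfolding bij_betw_def
proof (intro conjI inj_on_rep_positions set_eqI iffI)
  fix u :: "('v, 'f) trm" assume "u \<in> subt_at s ` rep ` (P - V)"
  then obtain q where q: "q \<in> rep ` (P - V)" "u = subt_at s q" by blast
  obtain x where "subt_at s q = Var x" using \<mu>_rep [OF q(1)] .
  then show "u \<in> Var ` rep_vars" using q rep_vars_iff by blast
next
  fix u :: "('v, 'f) trm" assume "u \<in> Var ` rep_vars"
  then obtain q where "q \<in> rep ` (P - V)" "subt_at s q = u" using rep_vars_iff by blast
  then show "u \<in> subt_at s ` rep ` (P - V)" by (metis image_eqI)
qed

text \<open>\<open>\<mu>\<close> replaces a variable only by something the constraint forces to be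
  equal to it.\<close>

lemma eval_\<mu>:
  assumes "valuation M \<rho>" "sat_ec M \<rho> C" "x \<in> X"
  shows "eval_trm M \<rho> (\<mu> x) = \<rho> x"
proof -
  obtain p where p: "p \<in> P" "subt_at s p = Var x" using X_pos [OF assms(3)] .
  show ?thesis
  proof (cases "p \<in> V")
    case True
    obtain v where "\<mu> x = val v" "entails_eq M C (Var x) (val v)"
      using \<mu>_V [OF True p(2) assms(3)] .
    then show ?thesis using assms by (simp add: entails_eq_def)
  next
    case False
    then have "\<mu> x = subt_at s (rep p)" using \<mu>_not_V p assms by simp
    then show ?thesis using rep_entails_eq [OF p(1)] p(2) assms by (simp add: entails_eq_def)
  qed
qed

text \<open>Here \<rho> need not solve \<open>C\<close>, so the sort of \<open>\<mu> x\<close> has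
  to be known. Under a solution \<rho>0 the terms \<open>x\<close> and \<open>\<mu> x\<close> share
  a value, and disjointness of carriers then yields equal sorts.\<close>

lemma eval_\<mu>_carr:
  assumes "valuation M \<rho>" "x \<in> X"
  shows "eval_trm M \<rho> (\<mu> x) \<in> carr M (vsort M x)"
proof -
  obtain \<rho>0 where \<rho>0: "valuation M \<rho>0" "sat_ec M \<rho>0 C" using sat by (auto simp: satisfiable_def)
  have x: "vsort M x \<in> tsorts M" "\<rho>0 x \<in> carr M (vsort M x)"
    using assms(2) \<rho>0(1) ectD(1) by (auto simp: valuation_def)
  have ev: "eval_trm M \<rho>0 (\<mu> x) = \<rho>0 x" using eval_\<mu> [OF \<rho>0 assms(2)] .
  obtain p where p: "p \<in> P" "subt_at s p = Var x" using X_pos [OF assms(2)] .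
  show ?thesis
  proof (cases "p \<in> V")
    case True
    obtain v where "\<mu> x = val v" using \<mu>_V [OF True p(2) assms(2)] .
    then show ?thesis using ev x by simp
  next
    case False
    then have m: "\<mu> x = subt_at s (rep p)" using \<mu>_not_V p assms by simp
    have "rep p \<in> P" using rep_in p by blast
    then have "eval_trm M \<rho>0 (\<mu> x) \<in> carr M (sort_of M (\<mu> x))" "sort_of M (\<mu> x) \<in> tsorts M"
      "eval_trm M \<rho> (\<mu> x) \<in> carr M (sort_of M (\<mu> x))"
      using eval_posXV(1,2) [OF ect] \<rho>0(1) assms(1) m by auto
    moreover from this have "sort_of M (\<mu> x) = vsort M x"
      using carr_Val ev x by metis
    ultimately show ?thesis by simp
  qed
qed

text \<open>\<open>\<mu> x\<close> is either a value or a variable in \<open>rep_vars\<close>, so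
  evaluation reads nothing else.\<close>

lemma eval_\<mu>_cong:
  assumes "\<And>x. x \<in> rep_vars \<Longrightarrow> \<rho> x = \<pi> x" "x \<in> X"
  shows "eval_trm M \<rho> (\<mu> x) = eval_trm M \<pi> (\<mu> x)"
proof -
  obtain p where p: "p \<in> P" "subt_at s p = Var x" using X_pos [OF assms(2)] .
  show ?thesis
  proof (cases "p \<in> V")
    case True
    obtain v where "\<mu> x = val v" using \<mu>_V [OF True p(2) assms(2)] .
    then show ?thesis by simp
  next
    case False
    then have m: "\<mu> x = subt_at s (rep p)" and q: "rep p \<in> rep ` (P - V)"
      using \<mu>_not_V p assms by auto
    obtain z where "subt_at s (rep p) = Var z" using \<mu>_rep [OF q] .
    moreover from this have "z \<in> rep_vars" using q rep_vars_iff by blast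
    ultimately show ?thesis using m assms(1) by simp
  qed
qed

end

text \<open>Condition (3) enters through the shared \<open>rep\<close>: two positions are equivalent
  iff they have the same representative, so one choice valid for both terms forces both equivalences
  to coincide. Condition (4) is \<open>entails_val\<close>.\<close>

locale rep_pair = S: rep_term M X s C rep + T: rep_term M Y t D rep
  for M :: "('s, 'v, 'f) lc_struct" and X s C Y t D rep +
  assumes pos: "posXV M X s = posXV M Y t"
    and entails_val: "\<And>p v. p \<in> posXV M X s \<Longrightarrow> v \<in> Val M \<Longrightarrow>
      entails_eq M C (subt_at s p) (val v) \<longleftrightarrow> entails_eq M D (subt_at t p) (val v)"
begin

lemma rep_pair_swap: "rep_pair M Y t D X s C rep"
proof
  show "posXV M Y t = posXV M X s" by (rule pos [symmetric])
  show "entails_eq M D (subt_at t p) (val v) \<longleftrightarrow> entails_eq M C (subt_at s p) (val v)"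
    if "p \<in> posXV M Y t" "v \<in> Val M" for p v
    using entails_val [of p v] that pos by blast
qed

lemma V_eq: "posVal1 M (X, s, C) = posVal1 M (Y, t, D)"
  using pos entails_val by (auto simp: posVal1_def)

abbreviation "Q \<equiv> rep ` (S.P - S.V)"

lemma Q_subset: "Q \<subseteq> S.P"
  using S.rep_in by blast

text \<open>
  Stating the transfer for two valuations that agree on representatives, instead of one valuation
  composed with \<open>\<theta>\<close> as in condition (5), makes it symmetric in the two terms.
\<close>

definition agree :: "('v \<Rightarrow> 'f) \<Rightarrow> ('v \<Rightarrow> 'f) \<Rightarrow> bool" where
  "agree \<rho> \<pi> \<longleftrightarrow> (\<forall>q\<in>Q. eval_trm M \<rho> (subt_at s q) = eval_trm M \<pi> (subt_at t q))"

definition constraint_transfer :: bool where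
  "constraint_transfer \<longleftrightarrow> (\<forall>\<rho> \<pi>. valuation M \<rho> \<longrightarrow> valuation M \<pi> \<longrightarrow> agree \<rho> \<pi> \<longrightarrow>
     sat_ec M (\<lambda>x. eval_trm M \<rho> (S.\<mu> x)) C \<longrightarrow> sat_ec M (\<lambda>y. eval_trm M \<pi> (T.\<mu> y)) D)"

text \<open>A valuation satisfying the instantiated constraint is turned into a solution of
  \<open>C\<close> by composing with \<open>S.\<mu>\<close>. The solution of \<open>D\<close> with
  the same tuple agrees with \<pi> on the representative variables of \<open>t\<close>, and these
  determine everything \<open>T.\<mu>\<close> produces.\<close>

lemma covers_imp_constraint_transfer:
  assumes "covers M S.P s C t D"
  shows constraint_transfer
  unfolding constraint_transfer_def
proof (intro allI impI)
  fix \<rho> \<pi>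
  assume \<rho>: "valuation M \<rho>" and \<pi>: "valuation M \<pi>" and ag: "agree \<rho> \<pi>"
    and sat: "sat_ec M (\<lambda>x. eval_trm M \<rho> (S.\<mu> x)) C"
  let ?\<rho> = "\<lambda>x. if x \<in> X then eval_trm M \<rho> (S.\<mu> x) else \<rho> x"
  have "valuation M ?\<rho>" using \<rho> S.eval_\<mu>_carr by (auto simp: valuation_def)
  moreover have "sat_ec M (\<lambda>x. eval_trm M \<rho> (S.\<mu> x)) C \<longleftrightarrow> sat_ec M ?\<rho> C"
    using S.ectD(3) by (intro S.sat_ec_cong [OF S.ectD(5)]) auto
  ultimately obtain \<rho>' where \<rho>': "valuation M \<rho>'" "sat_ec M \<rho>' D"
    "\<forall>p\<in>S.P. eval_trm M ?\<rho> (subt_at s p) = eval_trm M \<rho>' (subt_at t p)"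
    using assms sat unfolding covers_def by blast
  have "eval_trm M \<pi> (T.\<mu> y) = \<rho>' y" if y: "y \<in> Y" for y
  proof -
    have "eval_trm M \<pi> (T.\<mu> y) = eval_trm M \<rho>' (T.\<mu> y)"
    proof (rule T.eval_\<mu>_cong [OF _ y])
      fix z assume "z \<in> T.rep_vars"
      then obtain q where q: "q \<in> Q" "subt_at t q = Var z"
        using T.rep_vars_iff V_eq pos by auto
      obtain x where x: "x \<in> X" "subt_at s q = Var x" "S.\<mu> x = Var x" using S.\<mu>_rep [OF q(1)] .
      have "\<rho>' z = eval_trm M ?\<rho> (subt_at s q)" using \<rho>'(3) q Q_subset by auto
      also have "\<dots> = eval_trm M \<rho> (subt_at s q)" using x by simp
      also have "\<dots> = \<pi> z" using bspec [OF ag [unfolded agree_def] q(1)] q(2) by simp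
      finally show "\<pi> z = \<rho>' z" by simp
    qed
    then show ?thesis using T.eval_\<mu> [OF \<rho>'(1,2) y] by simp
  qed
  then have "sat_ec M (\<lambda>y. eval_trm M \<pi> (T.\<mu> y)) D \<longleftrightarrow> sat_ec M \<rho>' D"
    using T.ectD(3) by (intro S.sat_ec_cong [OF T.ectD(5)]) auto
  then show "sat_ec M (\<lambda>y. eval_trm M \<pi> (T.\<mu> y)) D" using \<rho>'(2) by simp
qed

text \<open>A tuple is rebuilt from its entries in \<open>Q\<close>: forced positions have the same
  value on both sides, all others repeat the entry of their representative. The sort assumption
  makes the rebuilt assignment a valuation.\<close>

lemma constraint_transfer_imp_covers:
  assumes trans: constraint_transfer
    and sorts: "\<And>q. q \<in> Q \<Longrightarrow> sort_of M (subt_at s q) = sort_of M (subt_at t q)"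
  shows "covers M S.P s C t D"
  unfolding covers_def
proof (intro allI impI, elim conjE)
  fix \<rho> assume \<rho>: "valuation M \<rho>" "sat_ec M \<rho> C"
  have Q_T: "Q = rep ` (T.P - T.V)" using pos V_eq by simp
  let ?i = "\<lambda>y. the_inv_into Q (subt_at t) (Var y)"
  \<comment> \<open>\<open>?i y\<close> is the unique position of \<open>Q\<close> at which
    \<open>t\<close> carries \<open>y\<close>, so \<pi> copies the entry of \<open>s\<close> there.
    Elsewhere \<rho> is a mere default with values in the right carriers.\<close>
  define \<pi> where "\<pi> y = (if y \<in> T.rep_vars then eval_trm M \<rho> (subt_at s (?i y)) else \<rho> y)" for y
  have \<pi>_rep: "y \<in> T.rep_vars \<and> \<pi> y = eval_trm M \<rho> (subt_at s q)" if "q \<in> Q" "subt_at t q = Var y" for q y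
  proof -
    have "?i y = q"
      using T.inj_on_rep_positions that by (intro the_inv_into_f_eq) (auto simp: Q_T)
    moreover have "y \<in> T.rep_vars" using that T.rep_vars_iff Q_T by auto
    ultimately show ?thesis by (simp add: \<pi>_def)
  qed
  have "\<pi> y \<in> carr M (vsort M y)" if "vsort M y \<in> tsorts M" for y
  proof (cases "y \<in> T.rep_vars")
    case True
    then obtain q where q: "q \<in> Q" "subt_at t q = Var y" using T.rep_vars_iff Q_T by auto
    then have "eval_trm M \<rho> (subt_at s q) \<in> carr M (sort_of M (subt_at s q))"
      using S.eval_posXV(1) [OF S.ect \<rho>(1)] Q_subset by blast
    then show ?thesis using \<pi>_rep [OF q] sorts [OF q(1)] q(2) by simp
  next
    case False
    then show ?thesis using \<rho>(1) that by (simp add: valuation_def \<pi>_def)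
  qed
  then have \<pi>: "valuation M \<pi>" unfolding valuation_def by blast
  have "eval_trm M \<rho> (subt_at s q) = eval_trm M \<pi> (subt_at t q)" if q: "q \<in> Q" for q
  proof -
    have "q \<in> rep ` (T.P - T.V)" using q Q_T by simp
    then obtain y where y: "subt_at t q = Var y" by (rule T.\<mu>_rep)
    then show ?thesis using \<pi>_rep [OF q y] by simp
  qed
  then have ag: "agree \<rho> \<pi>" unfolding agree_def by blast
  have "sat_ec M (\<lambda>x. eval_trm M \<rho> (S.\<mu> x)) C \<longleftrightarrow> sat_ec M \<rho> C"
    using S.ectD(3) S.eval_\<mu> [OF \<rho>] by (intro S.sat_ec_cong [OF S.ectD(5)]) auto
  then have satD: "sat_ec M (\<lambda>y. eval_trm M \<pi> (T.\<mu> y)) D"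
    using trans \<rho> \<pi> ag unfolding constraint_transfer_def by blast
  \<comment> \<open>\<pi> itself need not solve \<open>D\<close>; composing with
    \<open>T.\<mu>\<close> assigns the remaining variables of \<open>Y\<close> the values their
    class dictates.\<close>
  let ?\<pi>' = "\<lambda>y. if y \<in> Y then eval_trm M \<pi> (T.\<mu> y) else \<rho> y"
  have val: "valuation M ?\<pi>'" using \<rho>(1) T.eval_\<mu>_carr [OF \<pi>] unfolding valuation_def by simp
  have "sat_ec M (\<lambda>y. eval_trm M \<pi> (T.\<mu> y)) D \<longleftrightarrow> sat_ec M ?\<pi>' D"
    using T.ectD(3) by (intro S.sat_ec_cong [OF T.ectD(5)]) auto
  then have satD': "sat_ec M ?\<pi>' D" using satD by blast
  have "eval_trm M \<rho> (subt_at s p) = eval_trm M ?\<pi>' (subt_at t p)" if p: "p \<in> S.P" for p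
  proof (cases "p \<in> S.V")
    case True
    then obtain v where v: "v \<in> Val M" "entails_eq M C (subt_at s p) (val v)"
      by (auto simp: posVal1_def)
    then have "entails_eq M D (subt_at t p) (val v)" using entails_val p by blast
    then show ?thesis using v(2) \<rho> val satD' unfolding entails_eq_def by simp
  next
    case False
    then have pT: "p \<in> T.P - T.V" using p V_eq pos by simp
    then obtain y where y: "y \<in> Y" "subt_at t p = Var y" by (rule T.not_V_Var)
    have "eval_trm M ?\<pi>' (subt_at t p) = eval_trm M \<pi> (subt_at t (rep p))"
      using y T.\<mu>_not_V [OF pT y(2,1)] by simp
    also have "\<dots> = eval_trm M \<rho> (subt_at s (rep p))"
      using ag False p unfolding agree_def by simp
    also have "\<dots> = eval_trm M \<rho> (subt_at s p)"
      using S.rep_entails_eq [OF p] \<rho> by (simp add: entails_eq_def)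
    finally show ?thesis by simp
  qed
  then show "\<exists>\<pi>. valuation M \<pi> \<and> sat_ec M \<pi> D \<and>
      (\<forall>p\<in>S.P. eval_trm M \<rho> (subt_at s p) = eval_trm M \<pi> (subt_at t p))"
    using val satD' by (intro exI [of _ ?\<pi>']) blast
qed

lemma covers_sorts:
  assumes "covers M S.P s C t D" "p \<in> S.P"
  shows "sort_of M (subt_at s p) = sort_of M (subt_at t p)"
proof -
  obtain \<rho> where "valuation M \<rho>" "sat_ec M \<rho> C" using S.sat by (auto simp: satisfiable_def)
  then obtain \<pi> where "valuation M \<rho>" "valuation M \<pi>"
    "eval_trm M \<rho> (subt_at s p) = eval_trm M \<pi> (subt_at t p)"
    using assms unfolding covers_def by blast
  then show ?thesis
    using S.eval_posXV(1,2) [OF S.ect, of _ p] S.eval_posXV(1,2) [OF T.ect, of _ p] S.carr_Val assms(2) pos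
    by metis
qed

section \<open>The restricted relation between representative variables, and condition (5)\<close>

abbreviation "\<theta> \<equiv> restrict_rel {(subt_at s p, subt_at t p) | p. p \<in> S.P} S.rep_vars T.rep_vars"

text \<open>If both components at \<open>p\<close> are representative variables, the same pair
  already occurs at \<open>rep p\<close>, because one \<open>rep\<close> serves both terms.\<close>

lemma restrict_rel_eq: "\<theta> = (\<lambda>q. (subt_at s q, subt_at t q)) ` Q"
proof (intro set_eqI iffI)
  fix a assume "a \<in> \<theta>"
  moreover obtain u w where a: "a = (u, w)" by (cases a)
  ultimately have uw: "\<exists>p. u = subt_at s p \<and> w = subt_at t p \<and> p \<in> S.P"
      "u \<in> Var ` S.rep_vars" "w \<in> Var ` T.rep_vars"
    by (simp_all add: restrict_rel_def)
  then obtain p where p: "p \<in> S.P" "a = (subt_at s p, subt_at t p)"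
    "subt_at s p \<in> Var ` S.rep_vars" "subt_at t p \<in> Var ` T.rep_vars"
    using a by blast
  then obtain x y where xy: "subt_at s p = Var x" "x \<in> S.rep_vars" "subt_at t p = Var y" "y \<in> T.rep_vars"
    by blast
  then have "rep p \<in> Q" "subt_at s (rep p) = Var x" "subt_at t (rep p) = Var y"
    using p(1) S.rep_vars_pos T.rep_vars_pos(2) pos by auto
  then show "a \<in> (\<lambda>q. (subt_at s q, subt_at t q)) ` Q" using p xy by force
next
  fix a assume "a \<in> (\<lambda>q. (subt_at s q, subt_at t q)) ` Q"
  then obtain q where q: "q \<in> Q" "a = (subt_at s q, subt_at t q)" by blast
  then have qT: "q \<in> rep ` (T.P - T.V)" using pos V_eq by simp
  obtain x where x: "subt_at s q = Var x" using S.\<mu>_rep [OF q(1)] .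
  obtain y where y: "subt_at t q = Var y" using T.\<mu>_rep [OF qT] .
  have "x \<in> S.rep_vars" "y \<in> T.rep_vars"
    using x y q(1) qT S.rep_vars_iff T.rep_vars_iff by blast+
  moreover have "(subt_at s q, subt_at t q) \<in> {(subt_at s p, subt_at t p) | p. p \<in> S.P}"
    using q(1) Q_subset by blast
  ultimately show "a \<in> \<theta>" using q(2) x y by (simp add: restrict_rel_def)
qed

text \<open>Both subterm maps are injective on \<open>Q\<close>, with exactly the representative
  variables as images, so the relation is always a bijection and only the sorts can fail to
  match.\<close>

lemma renaming_rel_iff:
  "renaming_rel M S.rep_vars T.rep_vars \<theta> \<longleftrightarrow>
    (\<forall>q\<in>Q. sort_of M (subt_at s q) = sort_of M (subt_at t q))"
proof
  assume "renaming_rel M S.rep_vars T.rep_vars \<theta>"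
  then obtain r where r: "renaming M S.rep_vars T.rep_vars r" "\<theta> = (\<lambda>x. (Var x, Var (r x))) ` S.rep_vars"
    by (auto simp: renaming_rel_def)
  show "\<forall>q\<in>Q. sort_of M (subt_at s q) = sort_of M (subt_at t q)"
  proof
    fix q assume "q \<in> Q"
    then have "(subt_at s q, subt_at t q) \<in> \<theta>" unfolding restrict_rel_eq by blast
    then obtain x where "x \<in> S.rep_vars" "subt_at s q = Var x" "subt_at t q = Var (r x)"
      unfolding r(2) by blast
    then show "sort_of M (subt_at s q) = sort_of M (subt_at t q)"
      using r(1) by (simp add: renaming_def)
  qed
next
  assume sorts: "\<forall>q\<in>Q. sort_of M (subt_at s q) = sort_of M (subt_at t q)"
  have Q_T: "Q = rep ` (T.P - T.V)" using pos V_eq by simp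
  have bs: "bij_betw (subt_at s) Q (Var ` S.rep_vars)"
    by (rule S.bij_betw_rep_positions)
  have bt: "bij_betw (subt_at t) Q (Var ` T.rep_vars)"
    unfolding Q_T by (rule T.bij_betw_rep_positions)
  \<comment> \<open>\<open>g\<close> goes from a representative variable of \<open>s\<close> back to
    its position in \<open>Q\<close>; reading \<open>t\<close> at that position gives the
    renaming.\<close>
  define g where "g x = the_inv_into Q (subt_at s) (Var x)" for x
  have g: "g x \<in> Q" "subt_at s (g x) = Var x" if "x \<in> S.rep_vars" for x
    using bij_betw_the_inv_into [OF bs] f_the_inv_into_f_bij_betw [OF bs] that
    by (auto simp: g_def bij_betw_def)
  define r where "r x = (THE y. subt_at t (g x) = Var y)" for x
  have r: "subt_at t (g x) = Var (r x)" if x: "x \<in> S.rep_vars" for x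
  proof -
    have "subt_at t (g x) \<in> Var ` T.rep_vars" using g(1) [OF x] bt by (auto simp: bij_betw_def)
    then show ?thesis by (auto simp: r_def)
  qed
  have "bij_betw r S.rep_vars T.rep_vars"
    unfolding bij_betw_def
  proof
    show "inj_on r S.rep_vars"
    proof (rule inj_onI)
      fix x z assume xz: "x \<in> S.rep_vars" "z \<in> S.rep_vars" "r x = r z"
      then have "g x = g z" using r g(1) bt by (metis bij_betw_imp_inj_on inj_onD)
      then show "x = z" using g(2) xz by (metis trm.inject(1))
    qed
    show "r ` S.rep_vars = T.rep_vars"
    proof (intro set_eqI iffI)
      fix y assume "y \<in> r ` S.rep_vars"
      then obtain x where "x \<in> S.rep_vars" "y = r x" by blast
      then show "y \<in> T.rep_vars" using r g(1) T.rep_vars_iff Q_T by metis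
    next
      fix y assume "y \<in> T.rep_vars"
      then obtain q where q: "q \<in> Q" "subt_at t q = Var y" using T.rep_vars_iff Q_T by auto
      then obtain x where x: "x \<in> S.rep_vars" "subt_at s q = Var x" using bs by (auto simp: bij_betw_def)
      then have "g x = q" using g [OF x(1)] q(1) bs by (metis bij_betw_imp_inj_on inj_onD)
      then have "r x = y" using r [OF x(1)] q(2) by simp
      then show "y \<in> r ` S.rep_vars" using x by blast
    qed
  qed
  moreover have "vsort M (r x) = vsort M x" if "x \<in> S.rep_vars" for x
    using sorts g [OF that] r [OF that] by (metis sort_of.simps(1))
  moreover have "\<theta> = (\<lambda>x. (Var x, Var (r x))) ` S.rep_vars"
  proof -
    have gQ: "g ` S.rep_vars = Q"
    proof (intro set_eqI iffI)
      fix q assume q: "q \<in> Q"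
      then obtain x where x: "x \<in> S.rep_vars" "subt_at s q = Var x" using bs by (auto simp: bij_betw_def)
      then have "g x = q" using g [OF x(1)] q(1) bs by (metis bij_betw_imp_inj_on inj_onD)
      then show "q \<in> g ` S.rep_vars" using x by blast
    qed (use g(1) in blast)
    show ?thesis
      unfolding restrict_rel_eq gQ [symmetric] image_image using g(2) r by (intro image_cong) auto
  qed
  ultimately show "renaming_rel M S.rep_vars T.rep_vars \<theta>"
    unfolding renaming_rel_def renaming_def by blast
qed

lemma agree_iff:
  assumes "\<theta> = (\<lambda>x. (Var x, Var (r x))) ` S.rep_vars"
  shows "agree \<rho> \<pi> \<longleftrightarrow> (\<forall>x\<in>S.rep_vars. \<rho> x = \<pi> (r x))"
proof -
  have "agree \<rho> \<pi> \<longleftrightarrow> (\<forall>(u, w)\<in>\<theta>. eval_trm M \<rho> u = eval_trm M \<pi> w)"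
    unfolding agree_def restrict_rel_eq by simp
  then show ?thesis unfolding assms by simp
qed

text \<open>The substituted constraint evaluates \<open>C\<close> under \<pi> composed with the
  renaming. That valuation agrees with \<pi>, and any other \<rho> agreeing with \<pi> differs from
  it only outside \<open>S.rep_vars\<close>, which \<open>S.\<mu>\<close> never reads.\<close>

lemma valid_iff_eq:
  assumes "renaming_rel M S.rep_vars T.rep_vars \<theta>"
  shows "valid_iff M (subst_ec M (rel_to_subst \<theta>) (subst_ec M S.\<mu> C)) (subst_ec M T.\<mu> D) \<longleftrightarrow>
    (\<forall>\<rho> \<pi>. valuation M \<rho> \<longrightarrow> valuation M \<pi> \<longrightarrow> agree \<rho> \<pi> \<longrightarrow>
      (sat_ec M (\<lambda>x. eval_trm M \<rho> (S.\<mu> x)) C \<longleftrightarrow> sat_ec M (\<lambda>y. eval_trm M \<pi> (T.\<mu> y)) D))"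
    (is "?L \<longleftrightarrow> ?R")
proof -
  obtain r where r: "renaming M S.rep_vars T.rep_vars r"
    and \<theta>: "\<theta> = (\<lambda>x. (Var x, Var (r x))) ` S.rep_vars"
    using assms by (auto simp: renaming_rel_def)
  have rts: "rel_to_subst \<theta> x = Var (if x \<in> S.rep_vars then r x else x)" for x
    unfolding \<theta> by (auto simp: rel_to_subst_def)
  let ?\<rho> = "\<lambda>\<pi> x. if x \<in> S.rep_vars then \<pi> (r x) else \<pi> x"
  have L: "sat_ec M \<pi> (subst_ec M (rel_to_subst \<theta>) (subst_ec M S.\<mu> C)) \<longleftrightarrow>
      sat_ec M (\<lambda>x. eval_trm M (?\<rho> \<pi>) (S.\<mu> x)) C" for \<pi>
    unfolding S.sat_subst_ec(1) [OF S.sat_subst_ec(2) [OF S.ectD(5)]] S.sat_subst_ec(1) [OF S.ectD(5)] rts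
    by (simp add: if_distrib [of \<pi>])
  have R: "sat_ec M \<pi> (subst_ec M T.\<mu> D) \<longleftrightarrow> sat_ec M (\<lambda>y. eval_trm M \<pi> (T.\<mu> y)) D" for \<pi>
    by (rule S.sat_subst_ec(1) [OF T.ectD(5)])
  show ?thesis
  proof
    assume v: ?L
    show ?R
    proof (intro allI impI)
      fix \<rho> \<pi> assume \<rho>: "valuation M \<rho>" "valuation M \<pi>" "agree \<rho> \<pi>"
      have "sat_ec M (\<lambda>x. eval_trm M \<rho> (S.\<mu> x)) C \<longleftrightarrow> sat_ec M (\<lambda>x. eval_trm M (?\<rho> \<pi>) (S.\<mu> x)) C"
      proof (rule S.sat_ec_cong [OF S.ectD(5)])
        fix x assume "x \<in> FVar C"
        then have "x \<in> X" using S.ectD(3) by blast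
        then show "eval_trm M \<rho> (S.\<mu> x) = eval_trm M (?\<rho> \<pi>) (S.\<mu> x)"
          using \<rho>(3) agree_iff [OF \<theta>] by (intro S.eval_\<mu>_cong) auto
      qed
      then show "sat_ec M (\<lambda>x. eval_trm M \<rho> (S.\<mu> x)) C \<longleftrightarrow> sat_ec M (\<lambda>y. eval_trm M \<pi> (T.\<mu> y)) D"
        using v \<rho>(2) unfolding valid_iff_def L R by blast
    qed
  next
    assume v: ?R
    show ?L
      unfolding valid_iff_def L R
    proof (intro allI impI)
      fix \<pi> assume \<pi>: "valuation M \<pi>"
      have "\<pi> (r x) \<in> carr M (vsort M x)" if "x \<in> S.rep_vars" "vsort M x \<in> tsorts M" for x
        using r \<pi> that unfolding renaming_def valuation_def by metis
      then have "valuation M (?\<rho> \<pi>)" using \<pi> by (auto simp: valuation_def)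
      moreover have "agree (?\<rho> \<pi>) \<pi>" unfolding agree_iff [OF \<theta>] by simp
      ultimately show "sat_ec M (\<lambda>x. eval_trm M (?\<rho> \<pi>) (S.\<mu> x)) C \<longleftrightarrow>
          sat_ec M (\<lambda>y. eval_trm M \<pi> (T.\<mu> y)) D"
        using v \<pi> by blast
    qed
  qed
qed

text \<open>Each inclusion is one direction of the equivalence in (5), the second obtained by
  exchanging the terms. Recovering inclusions from transfers needs equal sorts on \<open>Q\<close>;
  the renaming supplies them in one direction, \<open>covers_sorts\<close> in the other.\<close>

lemma covers_iff:
  "covers M S.P s C t D \<and> covers M S.P t D s C \<longleftrightarrow>
    renaming_rel M S.rep_vars T.rep_vars \<theta> \<and>
    valid_iff M (subst_ec M (rel_to_subst \<theta>) (subst_ec M S.\<mu> C)) (subst_ec M T.\<mu> D)"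
proof -
  interpret swap: rep_pair M Y t D X s C rep by (rule rep_pair_swap)
  have agree_swap: "swap.agree \<pi> \<rho> \<longleftrightarrow> agree \<rho> \<pi>" for \<pi> \<rho>
    unfolding agree_def swap.agree_def pos V_eq by auto
  have tr: "constraint_transfer \<and> swap.constraint_transfer \<longleftrightarrow>
    (\<forall>\<rho> \<pi>. valuation M \<rho> \<longrightarrow> valuation M \<pi> \<longrightarrow> agree \<rho> \<pi> \<longrightarrow>
      (sat_ec M (\<lambda>x. eval_trm M \<rho> (S.\<mu> x)) C \<longleftrightarrow> sat_ec M (\<lambda>y. eval_trm M \<pi> (T.\<mu> y)) D))"
    unfolding constraint_transfer_def swap.constraint_transfer_def agree_swap by blast
  have sorts: "renaming_rel M S.rep_vars T.rep_vars \<theta>" if "covers M S.P s C t D"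
    unfolding renaming_rel_iff using covers_sorts [OF that] Q_subset by blast
  have eq: "covers M S.P s C t D \<longleftrightarrow> constraint_transfer" "covers M S.P t D s C \<longleftrightarrow> swap.constraint_transfer"
    if "renaming_rel M S.rep_vars T.rep_vars \<theta>"
  proof -
    note sorts = that [unfolded renaming_rel_iff, rule_format]
    show "covers M S.P s C t D \<longleftrightarrow> constraint_transfer"
      using covers_imp_constraint_transfer constraint_transfer_imp_covers sorts by blast
    have "sort_of M (subt_at t q) = sort_of M (subt_at s q)" if "q \<in> swap.Q" for q
      using that sorts [of q] pos V_eq by simp
    then show "covers M S.P t D s C \<longleftrightarrow> swap.constraint_transfer"
      using swap.covers_imp_constraint_transfer swap.constraint_transfer_imp_covers
      unfolding pos by blast
  qed
  show ?thesis using sorts eq valid_iff_eq tr by blast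
qed

end

theorem theorem4:
  fixes M :: "('s, 'v, 'f) lc_struct"
    and X Y :: "'v set" and s t \<phi> \<psi> :: "('v, 'f) trm" and xs ys :: "'v list"
    and P :: "pos set" and rep :: "pos \<Rightarrow> pos"
  assumes "lc_model M"
    and "ex_constrained_term M (X, s, (xs, \<phi>))" and "satisfiable M (xs, \<phi>)"
    and "ex_constrained_term M (Y, t, (ys, \<psi>))" and "satisfiable M (ys, \<psi>)"
    and "P = posXV M X s"
    and "representatives M (X, s, (xs, \<phi>)) rep"
  shows "equivalent M (X, s, (xs, \<phi>)) (Y, t, (ys, \<psi>)) \<longleftrightarrow>
      posXV M X s = posXV M Y t
    \<and> (\<exists>r. renaming M (vars_trm s - X) (vars_trm t - Y) r \<and>
           map_mctxt r id (mctxt_of P s) = mctxt_of P t)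
    \<and> (\<forall>p\<in>P. \<forall>q\<in>P. entails_eq M (xs, \<phi>) (subt_at s p) (subt_at s q) \<longleftrightarrow>
                    entails_eq M (ys, \<psi>) (subt_at t p) (subt_at t q))
    \<and> (\<forall>p\<in>P. \<forall>v\<in>Val M. entails_eq M (xs, \<phi>) (subt_at s p) (val v) \<longleftrightarrow>
                        entails_eq M (ys, \<psi>) (subt_at t p) (val v))
    \<and> (let \<mu>X = rep_subst M rep (X, s, (xs, \<phi>));
           \<mu>Y = rep_subst M rep (Y, t, (ys, \<psi>));
           \<theta> = {(subt_at s p, subt_at t p) | p. p \<in> P};
           X' = {x \<in> X. Var x \<in> \<mu>X ` X};
           Y' = {y \<in> Y. Var y \<in> \<mu>Y ` Y};
           \<theta>' = restrict_rel \<theta> X' Y'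
       in renaming_rel M X' Y' \<theta>' \<and>
          valid_iff M (subst_ec M (rel_to_subst \<theta>') (subst_ec M \<mu>X (xs, \<phi>)))
                      (subst_ec M \<mu>Y (ys, \<psi>)))"
    (is "_ \<longleftrightarrow> ?c1 \<and> ?c2 \<and> ?c3 \<and> ?c4 \<and> ?c5")
proof -
  interpret lc_model M by fact
  let ?cov = "covers M P s (xs, \<phi>) t (ys, \<psi>) \<and> covers M P t (ys, \<psi>) s (xs, \<phi>)"
  have c5: "?cov \<longleftrightarrow> ?c5" if pos: ?c1 and eqs: ?c3 and vals: ?c4
  proof -
    \<comment> \<open>By (1) and (3) the two equivalences coincide, so the representatives chosen
      for \<open>s\<close> are a valid choice for \<open>t\<close>.\<close>
    have pe: "pos_eq M (Y, t, (ys, \<psi>)) = pos_eq M (X, s, (xs, \<phi>))"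
      using pos eqs assms(6) by (auto simp: pos_eq_def)
    have rT: "representatives M (Y, t, (ys, \<psi>)) rep"
      using assms(7) pos unfolding representatives_def split pe by simp
    interpret rep_pair M X s "(xs, \<phi>)" Y t "(ys, \<psi>)" rep
      by unfold_locales (use assms rT pos vals in auto)
    show ?thesis
      using covers_iff assms(6) by (simp add: Let_def S.rep_vars_def T.rep_vars_def)
  qed
  \<comment> \<open>This discharges the side conditions of \<open>c5\<close> in the forward
    direction, where (3) and (4) are not given.\<close>
  have "?c3 \<and> ?c4" if ?cov
    using that covers_entails_eq [of M P t "(ys, \<psi>)" s "(xs, \<phi>)"]
      covers_entails_eq [of M P s "(xs, \<phi>)" t "(ys, \<psi>)"] by blast
  then show ?thesis
    unfolding equivalent_iff_covers [OF assms(2-6)] using c5 by blast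
qed

end
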